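(* Let $A=\sum\{A_{ij}\mid i,j\in I\}$ be a generalized matrix ring and let $r$ be one of $r_b$ (Baer radical), $r_l$ (Levitzki radical), $r_j$ (Jacobson radical). Then $r(A)=\mathrm{g.m.}\,r(A)=\sum\{r(A_{ij})\mid i,j\in I\}$.
   Context: A generalized matrix (gm) ring: $I$ is a nonempty index set; for $i,j\in I$, $A_{ij}$ are additive groups with biadditive associative maps $A_{ij}\times A_{jl}\to A_{il}$. $A$ is the external direct sum of the $A_{ij}$ with $(xy)_{ij}=\sum_k x_{ik}y_{kj}$. A gm ideal is an ideal $B$ of $A$ with $B=\sum\{B_{ij}\}$, $B_{ij}\subseteq A_{ij}$; $\mathrm{g.m.}\,r(A)$ denotes the largest gm ideal of $A$ contained in $r(A)$. On the left, $r(A)$ is the usual ring radical of $A$. Each $A_{ij}$ is regarded as a $\Gamma$-ring $M=A_{ij}$ with $\Gamma=A_{ji}$ (ternary product $M\times\Gamma\times M\to M$ given by the gm multiplication), and $r(A_{ij})$ denotes the corresponding radical of this $\Gamma$-ring: the Baer (prime) radical, the Levitzki (locally nilpotent) radical, and the Jacobson radical of $\Gamma$-rings in the sense of Coppage–Luh and Booth. *)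

theory Defs
  imports Main "HOL-Library.Function_Algebras"
begin

definition r_ideal :: "'r::ab_group_add set \<Rightarrow> ('r \<Rightarrow> 'r \<Rightarrow> 'r) \<Rightarrow> 'r set \<Rightarrow> bool" where
  "r_ideal R p J \<longleftrightarrow> J \<subseteq> R \<and> 0 \<in> J \<and> (\<forall>x\<in>J. \<forall>y\<in>J. x - y \<in> J)
     \<and> (\<forall>x\<in>J. \<forall>r\<in>R. p x r \<in> J \<and> p r x \<in> J)"

definition r_prime_ideal :: "'r::ab_group_add set \<Rightarrow> ('r \<Rightarrow> 'r \<Rightarrow> 'r) \<Rightarrow> 'r set \<Rightarrow> bool" where
  "r_prime_ideal R p P \<longleftrightarrow> r_ideal R p P \<and> P \<noteq> R \<and>
     (\<forall>I J. r_ideal R p I \<and> r_ideal R p J \<and> (\<forall>x\<in>I. \<forall>y\<in>J. p x y \<in> P) \<longrightarrow> I \<subseteq> P \<or> J \<subseteq> P)"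

fun lprod :: "('r \<Rightarrow> 'r \<Rightarrow> 'r) \<Rightarrow> 'r \<Rightarrow> 'r list \<Rightarrow> 'r" where
  "lprod p x [] = x"
| "lprod p x (y # ys) = p x (lprod p y ys)"

text \<open>S is locally nilpotent: every finite subset generates a nilpotent subring,
  i.e. all products of some fixed length of its elements vanish.\<close>
definition r_loc_nilpotent :: "('r::ab_group_add \<Rightarrow> 'r \<Rightarrow> 'r) \<Rightarrow> 'r set \<Rightarrow> bool" where
  "r_loc_nilpotent p S \<longleftrightarrow> (\<forall>F. finite F \<and> F \<subseteq> S \<longrightarrow>
     (\<exists>n. \<forall>x xs. x \<in> F \<and> set xs \<subseteq> F \<and> length xs = n \<longrightarrow> lprod p x xs = 0))"

definition r_rqr :: "'r::ab_group_add set \<Rightarrow> ('r \<Rightarrow> 'r \<Rightarrow> 'r) \<Rightarrow> 'r \<Rightarrow> bool" where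
  "r_rqr R p x \<longleftrightarrow> (\<exists>y\<in>R. x + y - p x y = 0)"

text \<open>Baer (prime) radical: intersection of all prime ideals (R if there are none).\<close>
definition r_baer :: "'r::ab_group_add set \<Rightarrow> ('r \<Rightarrow> 'r \<Rightarrow> 'r) \<Rightarrow> 'r set" where
  "r_baer R p = R \<inter> \<Inter>{P. r_prime_ideal R p P}"

text \<open>Levitzki radical: the sum of all locally nilpotent ideals.\<close>
definition r_levitzki :: "'r::ab_group_add set \<Rightarrow> ('r \<Rightarrow> 'r \<Rightarrow> 'r) \<Rightarrow> 'r set" where
  "r_levitzki R p = R \<inter> \<Inter>{K. r_ideal R p K \<and>
     (\<forall>J. r_ideal R p J \<and> r_loc_nilpotent p J \<longrightarrow> J \<subseteq> K)}"

text \<open>Jacobson radical: the sum of all (right) quasi-regular ideals.\<close>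
definition r_jacobson :: "'r::ab_group_add set \<Rightarrow> ('r \<Rightarrow> 'r \<Rightarrow> 'r) \<Rightarrow> 'r set" where
  "r_jacobson R p = R \<inter> \<Inter>{K. r_ideal R p K \<and>
     (\<forall>J. r_ideal R p J \<and> (\<forall>x\<in>J. r_rqr R p x) \<longrightarrow> J \<subseteq> K)}"

section \<open>Gamma-rings: M, Gamma, ternary product t x g y = x g y\<close>

definition g_ideal :: "'m::ab_group_add set \<Rightarrow> 'g set \<Rightarrow> ('m \<Rightarrow> 'g \<Rightarrow> 'm \<Rightarrow> 'm) \<Rightarrow> 'm set \<Rightarrow> bool" where
  "g_ideal M G t J \<longleftrightarrow> J \<subseteq> M \<and> 0 \<in> J \<and> (\<forall>x\<in>J. \<forall>y\<in>J. x - y \<in> J)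
     \<and> (\<forall>x\<in>J. \<forall>g\<in>G. \<forall>m\<in>M. t x g m \<in> J \<and> t m g x \<in> J)"

definition g_prime_ideal :: "'m::ab_group_add set \<Rightarrow> 'g set \<Rightarrow> ('m \<Rightarrow> 'g \<Rightarrow> 'm \<Rightarrow> 'm) \<Rightarrow> 'm set \<Rightarrow> bool" where
  "g_prime_ideal M G t P \<longleftrightarrow> g_ideal M G t P \<and> P \<noteq> M \<and>
     (\<forall>I J. g_ideal M G t I \<and> g_ideal M G t J \<and> (\<forall>x\<in>I. \<forall>g\<in>G. \<forall>y\<in>J. t x g y \<in> P)
        \<longrightarrow> I \<subseteq> P \<or> J \<subseteq> P)"

fun gprod :: "('m \<Rightarrow> 'g \<Rightarrow> 'm \<Rightarrow> 'm) \<Rightarrow> 'm \<Rightarrow> ('g \<times> 'm) list \<Rightarrow> 'm" where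
  "gprod t x [] = x"
| "gprod t x ((g, y) # ys) = t x g (gprod t y ys)"

text \<open>S locally nilpotent (Coppage-Luh): for finite F in S and finite Phi in Gamma,
  (F Phi)^n F = 0 for some n.\<close>
definition g_loc_nilpotent :: "'g set \<Rightarrow> ('m::ab_group_add \<Rightarrow> 'g \<Rightarrow> 'm \<Rightarrow> 'm) \<Rightarrow> 'm set \<Rightarrow> bool" where
  "g_loc_nilpotent G t S \<longleftrightarrow> (\<forall>F \<Phi>. finite F \<and> F \<subseteq> S \<and> finite \<Phi> \<and> \<Phi> \<subseteq> G \<longrightarrow>
     (\<exists>n. \<forall>x ys. x \<in> F \<and> set ys \<subseteq> \<Phi> \<times> F \<and> length ys = n \<longrightarrow> gprod t x ys = 0))"

definition g_rqr :: "'m::ab_group_add set \<Rightarrow> 'g set \<Rightarrow> ('m \<Rightarrow> 'g \<Rightarrow> 'm \<Rightarrow> 'm) \<Rightarrow> 'm \<Rightarrow> bool" where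
  "g_rqr M G t x \<longleftrightarrow> (\<forall>g\<in>G. \<exists>y\<in>M. x + y - t x g y = 0)"

definition g_baer :: "'m::ab_group_add set \<Rightarrow> 'g set \<Rightarrow> ('m \<Rightarrow> 'g \<Rightarrow> 'm \<Rightarrow> 'm) \<Rightarrow> 'm set" where
  "g_baer M G t = M \<inter> \<Inter>{P. g_prime_ideal M G t P}"

definition g_levitzki :: "'m::ab_group_add set \<Rightarrow> 'g set \<Rightarrow> ('m \<Rightarrow> 'g \<Rightarrow> 'm \<Rightarrow> 'm) \<Rightarrow> 'm set" where
  "g_levitzki M G t = M \<inter> \<Inter>{K. g_ideal M G t K \<and>
     (\<forall>J. g_ideal M G t J \<and> g_loc_nilpotent G t J \<longrightarrow> J \<subseteq> K)}"

definition g_jacobson :: "'m::ab_group_add set \<Rightarrow> 'g set \<Rightarrow> ('m \<Rightarrow> 'g \<Rightarrow> 'm \<Rightarrow> 'm) \<Rightarrow> 'm set" where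
  "g_jacobson M G t = M \<inter> \<Inter>{K. g_ideal M G t K \<and>
     (\<forall>J. g_ideal M G t J \<and> (\<forall>x\<in>J. g_rqr M G t x) \<longrightarrow> J \<subseteq> K)}"

datatype rad_kind = Baer | Levitzki | Jacobson

fun ring_rad :: "rad_kind \<Rightarrow> 'r::ab_group_add set \<Rightarrow> ('r \<Rightarrow> 'r \<Rightarrow> 'r) \<Rightarrow> 'r set" where
  "ring_rad Baer = r_baer"
| "ring_rad Levitzki = r_levitzki"
| "ring_rad Jacobson = r_jacobson"

fun gamma_rad :: "rad_kind \<Rightarrow> 'm::ab_group_add set \<Rightarrow> 'g set \<Rightarrow> ('m \<Rightarrow> 'g \<Rightarrow> 'm \<Rightarrow> 'm) \<Rightarrow> 'm set" where
  "gamma_rad Baer = g_baer"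
| "gamma_rad Levitzki = g_levitzki"
| "gamma_rad Jacobson = g_jacobson"

text \<open>Index set I; components C i j (additive subgroups of an ambient abelian group 'a);
  mu i j l x y is the product A_ij x A_jl -> A_il.\<close>
definition gm_ring :: "'i set \<Rightarrow> ('i \<Rightarrow> 'i \<Rightarrow> 'a::ab_group_add set)
    \<Rightarrow> ('i \<Rightarrow> 'i \<Rightarrow> 'i \<Rightarrow> 'a \<Rightarrow> 'a \<Rightarrow> 'a) \<Rightarrow> bool" where
  "gm_ring I C mu \<longleftrightarrow> I \<noteq> {} \<and>
    (\<forall>i\<in>I. \<forall>j\<in>I. 0 \<in> C i j \<and> (\<forall>x\<in>C i j. \<forall>y\<in>C i j. x - y \<in> C i j)) \<and>
    (\<forall>i\<in>I. \<forall>j\<in>I. \<forall>l\<in>I. \<forall>x\<in>C i j. \<forall>y\<in>C j l. mu i j l x y \<in> C i l) \<and>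
    (\<forall>i\<in>I. \<forall>j\<in>I. \<forall>l\<in>I. \<forall>x\<in>C i j. \<forall>x'\<in>C i j. \<forall>y\<in>C j l. \<forall>y'\<in>C j l.
        mu i j l (x + x') y = mu i j l x y + mu i j l x' y \<and>
        mu i j l x (y + y') = mu i j l x y + mu i j l x y') \<and>
    (\<forall>i\<in>I. \<forall>j\<in>I. \<forall>k\<in>I. \<forall>l\<in>I. \<forall>x\<in>C i j. \<forall>y\<in>C j k. \<forall>z\<in>C k l.
        mu i k l (mu i j k x y) z = mu i j l x (mu j k l y z))"

text \<open>Elements of the external direct sum A: finitely supported matrices with entries in C i j.\<close>
definition gm_carrier :: "'i set \<Rightarrow> ('i \<Rightarrow> 'i \<Rightarrow> 'a::ab_group_add set) \<Rightarrow> ('i \<Rightarrow> 'i \<Rightarrow> 'a) set" where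
  "gm_carrier I C = {x. (\<forall>i j. x i j \<in> (if i \<in> I \<and> j \<in> I then C i j else {0}))
      \<and> finite {(i, j). x i j \<noteq> 0}}"

definition gm_mult :: "'i set \<Rightarrow> ('i \<Rightarrow> 'i \<Rightarrow> 'i \<Rightarrow> 'a \<Rightarrow> 'a \<Rightarrow> 'a)
    \<Rightarrow> ('i \<Rightarrow> 'i \<Rightarrow> 'a::ab_group_add) \<Rightarrow> ('i \<Rightarrow> 'i \<Rightarrow> 'a) \<Rightarrow> ('i \<Rightarrow> 'i \<Rightarrow> 'a)" where
  "gm_mult I mu x y = (\<lambda>i j. if i \<in> I \<and> j \<in> I
      then (\<Sum>k\<in>{k\<in>I. x i k \<noteq> 0}. mu i k j (x i k) (y k j)) else 0)"

text \<open>The sum of subsets S i j of the components: the set of elements of A whose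
  (i,j)-component lies in S i j.\<close>
definition gm_sum :: "'i set \<Rightarrow> ('i \<Rightarrow> 'i \<Rightarrow> 'a::ab_group_add set) \<Rightarrow> ('i \<Rightarrow> 'i \<Rightarrow> 'a set)
    \<Rightarrow> ('i \<Rightarrow> 'i \<Rightarrow> 'a) set" where
  "gm_sum I C S = {x \<in> gm_carrier I C. \<forall>i\<in>I. \<forall>j\<in>I. x i j \<in> S i j}"

definition gm_ideal :: "'i set \<Rightarrow> ('i \<Rightarrow> 'i \<Rightarrow> 'a::ab_group_add set)
    \<Rightarrow> ('i \<Rightarrow> 'i \<Rightarrow> 'i \<Rightarrow> 'a \<Rightarrow> 'a \<Rightarrow> 'a) \<Rightarrow> ('i \<Rightarrow> 'i \<Rightarrow> 'a) set \<Rightarrow> bool" where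
  "gm_ideal I C mu B \<longleftrightarrow> r_ideal (gm_carrier I C) (gm_mult I mu) B \<and>
     (\<exists>S. (\<forall>i\<in>I. \<forall>j\<in>I. S i j \<subseteq> C i j) \<and> B = gm_sum I C S)"

definition gm_rad :: "rad_kind \<Rightarrow> 'i set \<Rightarrow> ('i \<Rightarrow> 'i \<Rightarrow> 'a::ab_group_add set)
    \<Rightarrow> ('i \<Rightarrow> 'i \<Rightarrow> 'i \<Rightarrow> 'a \<Rightarrow> 'a \<Rightarrow> 'a) \<Rightarrow> ('i \<Rightarrow> 'i \<Rightarrow> 'a) set" where
  "gm_rad k I C mu = ring_rad k (gm_carrier I C) (gm_mult I mu)"

text \<open>g.m. r(A): the largest gm ideal of A contained in r(A).\<close>
definition gm_part_rad :: "rad_kind \<Rightarrow> 'i set \<Rightarrow> ('i \<Rightarrow> 'i \<Rightarrow> 'a::ab_group_add set)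
    \<Rightarrow> ('i \<Rightarrow> 'i \<Rightarrow> 'i \<Rightarrow> 'a \<Rightarrow> 'a \<Rightarrow> 'a) \<Rightarrow> ('i \<Rightarrow> 'i \<Rightarrow> 'a) set" where
  "gm_part_rad k I C mu = (THE B. gm_ideal I C mu B \<and> B \<subseteq> gm_rad k I C mu \<and>
     (\<forall>B'. gm_ideal I C mu B' \<and> B' \<subseteq> gm_rad k I C mu \<longrightarrow> B' \<subseteq> B))"

text \<open>A_ij as a Gamma-ring with M = A_ij, Gamma = A_ji, x g y = (x g) y.\<close>
definition gm_tern :: "('i \<Rightarrow> 'i \<Rightarrow> 'i \<Rightarrow> 'a \<Rightarrow> 'a \<Rightarrow> 'a) \<Rightarrow> 'i \<Rightarrow> 'i \<Rightarrow> 'a \<Rightarrow> 'a \<Rightarrow> 'a \<Rightarrow> 'a" where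
  "gm_tern mu i j x g y = mu i i j (mu i j i x g) y"

definition comp_rad :: "rad_kind \<Rightarrow> ('i \<Rightarrow> 'i \<Rightarrow> 'a::ab_group_add set)
    \<Rightarrow> ('i \<Rightarrow> 'i \<Rightarrow> 'i \<Rightarrow> 'a \<Rightarrow> 'a \<Rightarrow> 'a) \<Rightarrow> 'i \<Rightarrow> 'i \<Rightarrow> 'a set" where
  "comp_rad k C mu i j = gamma_rad k (C i j) (C j i) (gm_tern mu i j)"

end

theory Submission
  imports Defs
begin

text \<open>
  Write \<open>E\<^sub>i\<^sub>j(a)\<close> (\<open>single i j a\<close> below) for the matrix whose only nonzero entry is \<open>a\<close>
  at \<open>(i, j)\<close>. Every element of \<open>A\<close> is a finite sum of such matrix units, so an ideal \<open>X\<close> of \<open>A\<close> equals the set of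
  matrices with entries in \<open>S\<^sub>i\<^sub>j\<close> as soon as the \<open>(i, j)\<close>-entries of \<open>X\<close> lie in \<open>S\<^sub>i\<^sub>j\<close> and
  \<open>E\<^sub>i\<^sub>j(S\<^sub>i\<^sub>j) \<subseteq> X\<close>. For each of the three radicals both inclusions hold with
  \<open>S\<^sub>i\<^sub>j = r(A\<^sub>i\<^sub>j)\<close>; in particular \<open>r(A)\<close> is a gm ideal, hence equal to \<open>g.m. r(A)\<close>.

  Baer: a prime ideal \<open>Q\<close> of \<open>A\<^sub>i\<^sub>j\<close> lifts to the prime ideal
  \<open>{x. A\<^sub>i\<^sub>k x\<^sub>k\<^sub>l A\<^sub>l\<^sub>j \<subseteq> Q for all k, l}\<close> of \<open>A\<close>, and a prime ideal \<open>P\<close> of \<open>A\<close> cuts down to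
  \<open>{a. E\<^sub>i\<^sub>j(a) \<in> P}\<close>, which is all of \<open>A\<^sub>i\<^sub>j\<close> or prime.

  Jacobson: a quasi-inverse of \<open>x E\<^sub>j\<^sub>i(g)\<close> in \<open>A\<close> yields a quasi-inverse of \<open>x\<^sub>i\<^sub>j g\<close> in
  \<open>A\<^sub>i\<^sub>i\<close> and thereby a \<open>g\<close>-quasi-inverse of \<open>x\<^sub>i\<^sub>j\<close>. Conversely, if \<open>n\<close> is \<open>\<Gamma>\<close>-quasi-regular,
  every \<open>E\<^sub>i\<^sub>j(n) y\<close> lies in the right ideal of matrices supported in row \<open>i\<close> whose
  \<open>(i, i)\<close>-entry and whose products \<open>x\<^sub>i\<^sub>l c\<close> (\<open>c \<in> A\<^sub>l\<^sub>i\<close>) lie in \<open>J(A\<^sub>i\<^sub>i)\<close>; this right ideal is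
  quasi-regular, so \<open>E\<^sub>i\<^sub>j(n) \<in> J(A)\<close>.

  Levitzki: a \<open>\<Gamma>\<close>-product \<open>x g\<^sub>1 y\<^sub>1 \<dots> g\<^sub>k y\<^sub>k\<close> is the \<open>(i, j)\<close>-entry of the ring product
  \<open>(X E\<^sub>j\<^sub>i(g\<^sub>1)) \<dots> (Y\<^sub>k\<^sub>-\<^sub>1 E\<^sub>j\<^sub>i(g\<^sub>k)) Y\<^sub>k\<close> of lifts. Conversely, for a locally nilpotent \<open>N\<close>,
  products in \<open>A\<^sub>i\<^sub>i\<close> of elements \<open>n g\<close> (and \<open>n\<close> if \<open>i = j\<close>) regroup into \<open>\<Gamma>\<close>-products, so
  the analogous row right ideal containing \<open>E\<^sub>i\<^sub>j(N)\<close> is locally nilpotent, and locally nilpotent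
  right ideals lie in the Levitzki radical.
\<close>

section \<open>Rings without unit\<close>

lemma subgroup_sum_mem:
  fixes D :: "'a::ab_group_add set"
  assumes "0 \<in> D" "\<And>x y. x \<in> D \<Longrightarrow> y \<in> D \<Longrightarrow> x - y \<in> D" "\<And>k. k \<in> K \<Longrightarrow> f k \<in> D"
  shows "sum f K \<in> D"
  using assms(3)
proof (induction K rule: infinite_finite_induct)
  case (insert k K)
  then have "f k \<in> D" "sum f K \<in> D" by auto
  then show ?case
    using insert.hyps assms(2)[of 0 "sum f K"] assms(2)[of "f k" "- sum f K"] assms(1) by simp
qed (use assms(1) in auto)

definition r_right_ideal :: "'r::ab_group_add set \<Rightarrow> ('r \<Rightarrow> 'r \<Rightarrow> 'r) \<Rightarrow> 'r set \<Rightarrow> bool" where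
  "r_right_ideal R p L \<longleftrightarrow> L \<subseteq> R \<and> 0 \<in> L \<and> (\<forall>x\<in>L. \<forall>y\<in>L. x - y \<in> L)
     \<and> (\<forall>x\<in>L. \<forall>r\<in>R. p x r \<in> L)"

lemma r_right_ideal_subset: "r_right_ideal R p L \<Longrightarrow> L \<subseteq> R"
  unfolding r_right_ideal_def by blast

lemma r_right_ideal_zero: "r_right_ideal R p L \<Longrightarrow> 0 \<in> L"
  unfolding r_right_ideal_def by blast

lemma r_right_ideal_diff: "r_right_ideal R p L \<Longrightarrow> x \<in> L \<Longrightarrow> y \<in> L \<Longrightarrow> x - y \<in> L"
  unfolding r_right_ideal_def by blast

lemma r_right_ideal_mult: "r_right_ideal R p L \<Longrightarrow> x \<in> L \<Longrightarrow> r \<in> R \<Longrightarrow> p x r \<in> L"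
  unfolding r_right_ideal_def by blast

lemma r_ideal_subset: "r_ideal R p J \<Longrightarrow> J \<subseteq> R"
  unfolding r_ideal_def by blast

lemma r_ideal_zero: "r_ideal R p J \<Longrightarrow> 0 \<in> J"
  unfolding r_ideal_def by blast

lemma r_ideal_diff: "r_ideal R p J \<Longrightarrow> x \<in> J \<Longrightarrow> y \<in> J \<Longrightarrow> x - y \<in> J"
  unfolding r_ideal_def by blast

lemma r_ideal_mult_right: "r_ideal R p J \<Longrightarrow> x \<in> J \<Longrightarrow> r \<in> R \<Longrightarrow> p x r \<in> J"
  unfolding r_ideal_def by blast

lemma r_ideal_mult_left: "r_ideal R p J \<Longrightarrow> x \<in> J \<Longrightarrow> r \<in> R \<Longrightarrow> p r x \<in> J"
  unfolding r_ideal_def by blast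

lemma r_ideal_imp_right_ideal: "r_ideal R p J \<Longrightarrow> r_right_ideal R p J"
  unfolding r_ideal_def r_right_ideal_def by blast

lemma r_ideal_add: "r_ideal R p J \<Longrightarrow> x \<in> J \<Longrightarrow> y \<in> J \<Longrightarrow> x + y \<in> J"
  using r_ideal_diff[of R p J 0 y] r_ideal_diff[of R p J x "- y"] r_ideal_zero by fastforce

locale rng =
  fixes R :: "'r::ab_group_add set" and p :: "'r \<Rightarrow> 'r \<Rightarrow> 'r"
  assumes zero_closed: "0 \<in> R"
    and diff_closed: "x \<in> R \<Longrightarrow> y \<in> R \<Longrightarrow> x - y \<in> R"
    and mult_closed: "x \<in> R \<Longrightarrow> y \<in> R \<Longrightarrow> p x y \<in> R"
    and distrib_right: "x \<in> R \<Longrightarrow> y \<in> R \<Longrightarrow> z \<in> R \<Longrightarrow> p (x + y) z = p x z + p y z"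
    and distrib_left: "x \<in> R \<Longrightarrow> y \<in> R \<Longrightarrow> z \<in> R \<Longrightarrow> p x (y + z) = p x y + p x z"
    and assoc: "x \<in> R \<Longrightarrow> y \<in> R \<Longrightarrow> z \<in> R \<Longrightarrow> p (p x y) z = p x (p y z)"
begin

lemma neg_closed: "y \<in> R \<Longrightarrow> - y \<in> R"
  using diff_closed[of 0 y] zero_closed by simp

lemma add_closed: "x \<in> R \<Longrightarrow> y \<in> R \<Longrightarrow> x + y \<in> R"
  using diff_closed[of x "- y"] neg_closed by simp

lemma mult_zero_left: "y \<in> R \<Longrightarrow> p 0 y = 0"
  using distrib_right[of 0 0 y] zero_closed by simp

lemma mult_zero_right: "x \<in> R \<Longrightarrow> p x 0 = 0"
  using distrib_left[of x 0 0] zero_closed by simp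

lemma left_diff_distrib: "x \<in> R \<Longrightarrow> y \<in> R \<Longrightarrow> z \<in> R \<Longrightarrow> p (x - y) z = p x z - p y z"
  using distrib_right[of "x - y" y z] diff_closed by (simp add: algebra_simps)

lemma right_diff_distrib: "x \<in> R \<Longrightarrow> y \<in> R \<Longrightarrow> z \<in> R \<Longrightarrow> p x (y - z) = p x y - p x z"
  using distrib_left[of x "y - z" z] diff_closed by (simp add: algebra_simps)

lemma mult_minus_right: "x \<in> R \<Longrightarrow> z \<in> R \<Longrightarrow> p x (- z) = - p x z"
  using right_diff_distrib[of x 0 z] zero_closed mult_zero_right by simp

lemma lprod_closed: "x \<in> R \<Longrightarrow> set xs \<subseteq> R \<Longrightarrow> lprod p x xs \<in> R"
  by (induction xs arbitrary: x) (auto intro: mult_closed)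

lemma lprod_snoc: "x \<in> R \<Longrightarrow> set xs \<subseteq> R \<Longrightarrow> y \<in> R \<Longrightarrow> lprod p x (xs @ [y]) = p (lprod p x xs) y"
  by (induction xs arbitrary: x) (simp_all add: assoc lprod_closed)

lemma carrier_ideal: "r_ideal R p R"
  unfolding r_ideal_def using zero_closed diff_closed mult_closed by blast

lemma ideal_Inter: "(\<And>K. K \<in> F \<Longrightarrow> r_ideal R p K) \<Longrightarrow> r_ideal R p (R \<inter> \<Inter> F)"
  unfolding r_ideal_def using zero_closed diff_closed mult_closed by blast

lemma ideal_left_annihilator_mod:
  assumes P: "r_ideal R p P" and S: "S \<subseteq> R" "\<And>s r. s \<in> S \<Longrightarrow> r \<in> R \<Longrightarrow> p r s \<in> S"
  shows "r_ideal R p {z \<in> R. \<forall>s\<in>S. p z s \<in> P}"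
  unfolding r_ideal_def
proof (intro conjI ballI subsetI)
  fix x y assume "x \<in> {z \<in> R. \<forall>s\<in>S. p z s \<in> P}" "y \<in> {z \<in> R. \<forall>s\<in>S. p z s \<in> P}"
  with S(1) show "x - y \<in> {z \<in> R. \<forall>s\<in>S. p z s \<in> P}"
    by (auto simp: left_diff_distrib diff_closed subset_iff intro: r_ideal_diff[OF P])
next
  fix x r assume x: "x \<in> {z \<in> R. \<forall>s\<in>S. p z s \<in> P}" and r: "r \<in> R"
  with S show "p x r \<in> {z \<in> R. \<forall>s\<in>S. p z s \<in> P}"
    by (auto simp: assoc mult_closed subset_iff)
  from x r S(1) show "p r x \<in> {z \<in> R. \<forall>s\<in>S. p z s \<in> P}"
    by (auto simp: assoc mult_closed subset_iff intro: r_ideal_mult_left[OF P])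
qed (use zero_closed mult_zero_left S(1) r_ideal_zero[OF P] in auto)

lemma ideal_right_annihilator_mod:
  assumes P: "r_ideal R p P" and S: "S \<subseteq> R" "\<And>s r. s \<in> S \<Longrightarrow> r \<in> R \<Longrightarrow> p s r \<in> S"
  shows "r_ideal R p {w \<in> R. \<forall>s\<in>S. p s w \<in> P}"
  unfolding r_ideal_def
proof (intro conjI ballI subsetI)
  fix x y assume "x \<in> {w \<in> R. \<forall>s\<in>S. p s w \<in> P}" "y \<in> {w \<in> R. \<forall>s\<in>S. p s w \<in> P}"
  with S(1) show "x - y \<in> {w \<in> R. \<forall>s\<in>S. p s w \<in> P}"
    by (auto simp: right_diff_distrib diff_closed subset_iff intro: r_ideal_diff[OF P])
next
  fix x r assume x: "x \<in> {w \<in> R. \<forall>s\<in>S. p s w \<in> P}" and r: "r \<in> R"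
  from x r S(1) show "p x r \<in> {w \<in> R. \<forall>s\<in>S. p s w \<in> P}"
    by (auto simp: assoc[symmetric] mult_closed subset_iff intro: r_ideal_mult_right[OF P])
  from x r S show "p r x \<in> {w \<in> R. \<forall>s\<in>S. p s w \<in> P}"
    by (auto simp: assoc[symmetric] mult_closed subset_iff)
qed (use zero_closed mult_zero_right S(1) r_ideal_zero[OF P] in auto)

lemma prime_ideal_elem:
  assumes P: "r_prime_ideal R p P" and a: "a \<in> R" and b: "b \<in> R"
    and aRb: "\<And>y. y \<in> R \<Longrightarrow> p (p a y) b \<in> P"
  shows "a \<in> P \<or> b \<in> P"
proof -
  have Pi: "r_ideal R p P" and PR: "P \<noteq> R"
    and prime: "\<And>X Y. r_ideal R p X \<Longrightarrow> r_ideal R p Y \<Longrightarrow> (\<forall>x\<in>X. \<forall>y\<in>Y. p x y \<in> P)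
                  \<Longrightarrow> X \<subseteq> P \<or> Y \<subseteq> P"
    using P unfolding r_prime_ideal_def by blast+
  define Rb where "Rb = {p y b |y. y \<in> R}"
  define L where "L = {z \<in> R. \<forall>s\<in>Rb. p z s \<in> P}"
  define L' where "L' = {w \<in> R. \<forall>s\<in>L. p s w \<in> P}"
  have L: "r_ideal R p L"
    unfolding L_def Rb_def
    by (rule ideal_left_annihilator_mod[OF Pi]) (auto simp: b mult_closed assoc[symmetric])
  have L': "r_ideal R p L'"
    unfolding L'_def using ideal_right_annihilator_mod[OF Pi r_ideal_subset[OF L]]
    by (auto intro: r_ideal_mult_right[OF L])
  have "L \<subseteq> P \<or> L' \<subseteq> P"
    by (rule prime[OF L L']) (auto simp: L'_def)
  moreover have "a \<in> L"
    unfolding L_def Rb_def using a b aRb by (auto simp: assoc)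
  moreover have "b \<in> P" if "L' \<subseteq> P"
  proof -
    define Z where "Z = {w \<in> R. \<forall>s\<in>R. p s w \<in> P}"
    have Z: "r_ideal R p Z"
      unfolding Z_def by (rule ideal_right_annihilator_mod[OF Pi]) (auto intro: mult_closed)
    have "R \<subseteq> P \<or> Z \<subseteq> P"
      by (rule prime[OF carrier_ideal Z]) (auto simp: Z_def)
    moreover have "p y b \<in> L'" if "y \<in> R" for y
      unfolding L'_def L_def Rb_def using that b by (auto intro: mult_closed)
    then have "b \<in> Z" unfolding Z_def using b \<open>L' \<subseteq> P\<close> by blast
    ultimately show ?thesis using PR r_ideal_subset[OF Pi] by blast
  qed
  ultimately show ?thesis by blast
qed

lemma baer_ideal: "r_ideal R p (r_baer R p)"
  unfolding r_baer_def by (rule ideal_Inter) (simp add: r_prime_ideal_def)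

end

definition rqr_right_ideal :: "'r::ab_group_add set \<Rightarrow> ('r \<Rightarrow> 'r \<Rightarrow> 'r) \<Rightarrow> 'r set \<Rightarrow> bool" where
  "rqr_right_ideal R p L \<longleftrightarrow> r_right_ideal R p L \<and> (\<forall>x\<in>L. r_rqr R p x)"

context rng
begin

lemmas ring_simps = distrib_left distrib_right right_diff_distrib left_diff_distrib mult_minus_right
  assoc mult_closed add_closed diff_closed neg_closed

lemma circle_assoc:
  assumes "x \<in> R" "y \<in> R" "z \<in> R"
  shows "(x + y - p x y) + z - p (x + y - p x y) z = x + (y + z - p y z) - p x (y + z - p y z)"
  using assms by (simp add: ring_simps algebra_simps)

lemma rqr_mult_swap:
  assumes a: "a \<in> R" and b: "b \<in> R" and q: "r_rqr R p (p a b)"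
  shows "r_rqr R p (p b a)"
proof -
  obtain z where z: "z \<in> R" "p a b + z - p (p a b) z = 0"
    using q unfolding r_rqr_def by blast
  define w where "w = - p b a + p (p b z) a"
  have "p b a + w - p (p b a) w = p b (p (p a b + z - p (p a b) z) a)"
    unfolding w_def using a b z(1) by (simp add: ring_simps algebra_simps)
  also have "\<dots> = 0"
    using z(2) a b by (simp add: mult_zero_left mult_zero_right)
  finally have "p b a + w - p (p b a) w = 0" .
  moreover have "w \<in> R" unfolding w_def using a b z(1) by (simp add: ring_simps)
  ultimately show ?thesis unfolding r_rqr_def by blast
qed

lemma rqr_add:
  assumes a: "a \<in> R" and b: "b \<in> R" and z: "z \<in> R" "a + z - p a z = 0"
    and q: "r_rqr R p (b - p b z)"
  shows "r_rqr R p (a + b)"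
proof -
  have "(a + b) + z - p (a + b) z = b - p b z"
    using a b z by (simp add: distrib_right algebra_simps)
  with q obtain w where w: "w \<in> R" "((a + b) + z - p (a + b) z) + w - p ((a + b) + z - p (a + b) z) w = 0"
    unfolding r_rqr_def by auto
  then have "(a + b) + (z + w - p z w) - p (a + b) (z + w - p z w) = 0"
    using circle_assoc[OF add_closed[OF a b] z(1) w(1)] by simp
  moreover have "z + w - p z w \<in> R" using z(1) w(1) by (simp add: ring_simps)
  ultimately show ?thesis unfolding r_rqr_def by blast
qed

lemma rqr_right_ideal_zero: "rqr_right_ideal R p {0}"
  unfolding rqr_right_ideal_def r_right_ideal_def r_rqr_def
  using zero_closed mult_zero_left by auto

lemma right_ideal_sum:
  assumes L1: "r_right_ideal R p L1" and L2: "r_right_ideal R p L2"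
  shows "r_right_ideal R p {a + b |a b. a \<in> L1 \<and> b \<in> L2}"
  unfolding r_right_ideal_def
proof (intro conjI ballI subsetI)
  have "0 = 0 + (0::'r)" by simp
  then show "0 \<in> {a + b |a b. a \<in> L1 \<and> b \<in> L2}"
    using r_right_ideal_zero[OF L1] r_right_ideal_zero[OF L2] by blast
next
  fix x assume "x \<in> {a + b |a b. a \<in> L1 \<and> b \<in> L2}"
  then show "x \<in> R"
    using r_right_ideal_subset[OF L1] r_right_ideal_subset[OF L2] add_closed by blast
next
  fix x y assume "x \<in> {a + b |a b. a \<in> L1 \<and> b \<in> L2}" "y \<in> {a + b |a b. a \<in> L1 \<and> b \<in> L2}"
  then obtain a b a' b' where e: "x = a + b" "y = a' + b'" "a \<in> L1" "b \<in> L2" "a' \<in> L1" "b' \<in> L2"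
    by blast
  have "x - y = (a - a') + (b - b')" using e(1,2) by simp
  moreover have "a - a' \<in> L1" "b - b' \<in> L2"
    using e r_right_ideal_diff[OF L1] r_right_ideal_diff[OF L2] by blast+
  ultimately show "x - y \<in> {a + b |a b. a \<in> L1 \<and> b \<in> L2}" by blast
next
  fix x r assume "x \<in> {a + b |a b. a \<in> L1 \<and> b \<in> L2}" and r: "r \<in> R"
  then obtain a b where e: "x = a + b" "a \<in> L1" "b \<in> L2" by blast
  have "p x r = p a r + p b r"
    using e r r_right_ideal_subset[OF L1] r_right_ideal_subset[OF L2] distrib_right by blast
  moreover have "p a r \<in> L1" "p b r \<in> L2"
    using e r r_right_ideal_mult[OF L1] r_right_ideal_mult[OF L2] by blast+
  ultimately show "p x r \<in> {a + b |a b. a \<in> L1 \<and> b \<in> L2}" by blast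
qed

lemma rqr_right_ideal_sum:
  assumes L1: "rqr_right_ideal R p L1" and L2: "rqr_right_ideal R p L2"
  shows "rqr_right_ideal R p {a + b |a b. a \<in> L1 \<and> b \<in> L2}"
proof -
  have R1: "r_right_ideal R p L1" and R2: "r_right_ideal R p L2"
    and q1: "\<And>x. x \<in> L1 \<Longrightarrow> r_rqr R p x" and q2: "\<And>x. x \<in> L2 \<Longrightarrow> r_rqr R p x"
    using L1 L2 unfolding rqr_right_ideal_def by blast+
  have "r_rqr R p (a + b)" if ab: "a \<in> L1" "b \<in> L2" for a b
  proof -
    obtain z where z: "z \<in> R" "a + z - p a z = 0"
      using q1[OF ab(1)] unfolding r_rqr_def by blast
    have "b - p b z \<in> L2"
      using ab(2) z(1) r_right_ideal_diff[OF R2] r_right_ideal_mult[OF R2] by blast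
    then show ?thesis
      using rqr_add[OF _ _ z] q2 ab r_right_ideal_subset[OF R1] r_right_ideal_subset[OF R2] by blast
  qed
  then show ?thesis
    unfolding rqr_right_ideal_def using right_ideal_sum[OF R1 R2] by blast
qed

lemma rqr_right_ideal_mult_left:
  assumes L: "rqr_right_ideal R p L" and r: "r \<in> R"
  shows "rqr_right_ideal R p {p r l |l. l \<in> L}"
proof -
  have RL: "r_right_ideal R p L" and q: "\<And>x. x \<in> L \<Longrightarrow> r_rqr R p x"
    using L unfolding rqr_right_ideal_def by blast+
  note LR = r_right_ideal_subset[OF RL]
  have "r_right_ideal R p {p r l |l. l \<in> L}"
    unfolding r_right_ideal_def
  proof (intro conjI ballI subsetI)
    have "0 = p r 0" using mult_zero_right[OF r] by simp
    then show "0 \<in> {p r l |l. l \<in> L}"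
      using r_right_ideal_zero[OF RL] by blast
  next
    fix x assume "x \<in> {p r l |l. l \<in> L}"
    then show "x \<in> R" using LR r mult_closed by blast
  next
    fix x y assume "x \<in> {p r l |l. l \<in> L}" "y \<in> {p r l |l. l \<in> L}"
    then obtain a b where e: "x = p r a" "y = p r b" "a \<in> L" "b \<in> L" by blast
    have "x - y = p r (a - b)" using e LR r by (simp add: right_diff_distrib subset_iff)
    moreover have "a - b \<in> L" using e r_right_ideal_diff[OF RL] by blast
    ultimately show "x - y \<in> {p r l |l. l \<in> L}" by blast
  next
    fix x t assume "x \<in> {p r l |l. l \<in> L}" and t: "t \<in> R"
    then obtain a where e: "x = p r a" "a \<in> L" by blast
    have "p x t = p r (p a t)" using e LR r t by (simp add: assoc subset_iff)
    moreover have "p a t \<in> L" using e t r_right_ideal_mult[OF RL] by blast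
    ultimately show "p x t \<in> {p r l |l. l \<in> L}" by blast
  qed
  moreover have "r_rqr R p (p r l)" if "l \<in> L" for l
    using rqr_mult_swap[OF _ r q[OF r_right_ideal_mult[OF RL that r]]] that LR by blast
  ultimately show ?thesis unfolding rqr_right_ideal_def by blast
qed

lemma rqr_right_ideals_Union_ideal: "r_ideal R p (\<Union>{L. rqr_right_ideal R p L})"
  unfolding r_ideal_def
proof (intro conjI ballI)
  show "\<Union>{L. rqr_right_ideal R p L} \<subseteq> R"
    unfolding rqr_right_ideal_def using r_right_ideal_subset by blast
  show "0 \<in> \<Union>{L. rqr_right_ideal R p L}" using rqr_right_ideal_zero by blast
next
  fix x y assume "x \<in> \<Union>{L. rqr_right_ideal R p L}" "y \<in> \<Union>{L. rqr_right_ideal R p L}"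
  then obtain L1 L2 where L: "rqr_right_ideal R p L1" "x \<in> L1" "rqr_right_ideal R p L2" "y \<in> L2"
    by blast
  have "- y \<in> L2"
    using r_right_ideal_diff[of R p L2 0 y] r_right_ideal_zero[of R p L2] L(3,4)
    unfolding rqr_right_ideal_def by auto
  with L have "x - y \<in> {a + b |a b. a \<in> L1 \<and> b \<in> L2}" by force
  then show "x - y \<in> \<Union>{L. rqr_right_ideal R p L}"
    using rqr_right_ideal_sum[OF L(1) L(3)] by blast
next
  fix x r assume "x \<in> \<Union>{L. rqr_right_ideal R p L}" and r: "r \<in> R"
  then obtain L where L: "rqr_right_ideal R p L" "x \<in> L" by blast
  then show "p x r \<in> \<Union>{L. rqr_right_ideal R p L}"
    using r r_right_ideal_mult unfolding rqr_right_ideal_def by blast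
  have "p r x \<in> {p r l |l. l \<in> L}" using L by blast
  then show "p r x \<in> \<Union>{L. rqr_right_ideal R p L}"
    using rqr_right_ideal_mult_left[OF L(1) r] by blast
qed

lemma jacobson_eq_Union: "r_jacobson R p = \<Union>{L. rqr_right_ideal R p L}"
proof
  have "\<Union>{L. rqr_right_ideal R p L}
    \<in> {K. r_ideal R p K \<and> (\<forall>J. r_ideal R p J \<and> (\<forall>x\<in>J. r_rqr R p x) \<longrightarrow> J \<subseteq> K)}"
    using rqr_right_ideals_Union_ideal r_ideal_imp_right_ideal
    unfolding rqr_right_ideal_def by blast
  then show "r_jacobson R p \<subseteq> \<Union>{L. rqr_right_ideal R p L}"
    unfolding r_jacobson_def by blast
  show "\<Union>{L. rqr_right_ideal R p L} \<subseteq> r_jacobson R p"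
    unfolding r_jacobson_def using rqr_right_ideals_Union_ideal r_ideal_subset
    unfolding rqr_right_ideal_def by blast
qed

lemma jacobson_ideal: "r_ideal R p (r_jacobson R p)"
  using jacobson_eq_Union rqr_right_ideals_Union_ideal by simp

lemma jacobson_rqr: "x \<in> r_jacobson R p \<Longrightarrow> r_rqr R p x"
  unfolding jacobson_eq_Union rqr_right_ideal_def by blast

lemma rqr_right_ideal_subset_jacobson: "rqr_right_ideal R p L \<Longrightarrow> L \<subseteq> r_jacobson R p"
  unfolding jacobson_eq_Union by blast

lemma rqr_of_rqr_square:
  assumes x: "x \<in> R" and q: "r_rqr R p (p x x)"
  shows "r_rqr R p x"
proof -
  obtain z where z: "z \<in> R" "p x x + z - p (p x x) z = 0"
    using q unfolding r_rqr_def by blast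
  define y where "y = - x + z + p x z"
  have "x + y - p x y = p x x + z - p (p x x) z"
    unfolding y_def using x z(1) by (simp add: ring_simps algebra_simps)
  moreover have "y \<in> R" unfolding y_def using x z(1) by (simp add: ring_simps)
  ultimately show ?thesis unfolding r_rqr_def using z(2) by auto
qed

lemma jacobson_if_mult_right_jacobson:
  assumes x: "x \<in> R" and xR: "\<And>r. r \<in> R \<Longrightarrow> p x r \<in> r_jacobson R p"
  shows "x \<in> r_jacobson R p"
proof -
  let ?K = "{x \<in> R. \<forall>r\<in>R. p x r \<in> r_jacobson R p}"
  note J = jacobson_ideal
  have "r_right_ideal R p ?K"
    unfolding r_right_ideal_def
  proof (intro conjI ballI subsetI)
    show "0 \<in> ?K" using zero_closed mult_zero_left r_ideal_zero[OF J] by auto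
  next
    fix a b assume "a \<in> ?K" "b \<in> ?K"
    then show "a - b \<in> ?K" using diff_closed left_diff_distrib r_ideal_diff[OF J] by auto
  next
    fix a r assume "a \<in> ?K" "r \<in> R"
    then show "p a r \<in> ?K" using mult_closed assoc by auto
  qed auto
  moreover have "r_rqr R p a" if "a \<in> ?K" for a
    using that rqr_of_rqr_square jacobson_rqr by blast
  ultimately have "?K \<subseteq> r_jacobson R p"
    using rqr_right_ideal_subset_jacobson unfolding rqr_right_ideal_def by blast
  then show ?thesis using x xR by blast
qed

end

inductive_set gen_subgroup :: "'r::ab_group_add set \<Rightarrow> 'r set" for G where
  zero: "0 \<in> gen_subgroup G"
| gen: "g \<in> G \<Longrightarrow> g \<in> gen_subgroup G"
| diff: "a \<in> gen_subgroup G \<Longrightarrow> b \<in> gen_subgroup G \<Longrightarrow> a - b \<in> gen_subgroup G"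

lemma gen_subgroup_mono: "G \<subseteq> H \<Longrightarrow> x \<in> gen_subgroup G \<Longrightarrow> x \<in> gen_subgroup H"
  by (erule gen_subgroup.induct) (auto intro: gen_subgroup.intros)

lemma gen_subgroup_finite_support:
  "x \<in> gen_subgroup G \<Longrightarrow> \<exists>G'. finite G' \<and> G' \<subseteq> G \<and> x \<in> gen_subgroup G'"
proof (induction x rule: gen_subgroup.induct)
  case zero
  then show ?case by (auto intro: gen_subgroup.zero)
next
  case (gen g)
  then show ?case by (auto intro!: exI[of _ "{g}"] gen_subgroup.gen)
next
  case (diff a b)
  then obtain G1 G2 where "finite G1" "G1 \<subseteq> G" "a \<in> gen_subgroup G1"
    "finite G2" "G2 \<subseteq> G" "b \<in> gen_subgroup G2" by blast
  then show ?case
    by (intro exI[of _ "G1 \<union> G2"]) (auto intro: gen_subgroup.diff gen_subgroup_mono)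
qed

lemma finite_subset_gen_subgroup:
  assumes "finite F" "F \<subseteq> gen_subgroup G"
  shows "\<exists>G'. finite G' \<and> G' \<subseteq> G \<and> F \<subseteq> gen_subgroup G'"
proof -
  obtain g where g: "\<forall>x\<in>F. finite (g x) \<and> g x \<subseteq> G \<and> x \<in> gen_subgroup (g x)"
    using bchoice[of F] gen_subgroup_finite_support assms(2) by (metis subsetD)
  then have "F \<subseteq> gen_subgroup (\<Union>(g ` F))"
    by (meson UN_upper gen_subgroup_mono subsetI)
  then show ?thesis using g assms(1) by (intro exI[of _ "\<Union>(g ` F)"]) auto
qed

fun list_prod :: "('r \<Rightarrow> 'r \<Rightarrow> 'r) \<Rightarrow> 'r::zero list \<Rightarrow> 'r" where
  "list_prod p [] = 0"
| "list_prod p (x # xs) = lprod p x xs"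

lemma list_prod_Cons: "xs \<noteq> [] \<Longrightarrow> list_prod p (x # xs) = p x (list_prod p xs)"
  by (cases xs) auto

context rng
begin

lemma gen_subgroup_subset: "G \<subseteq> R \<Longrightarrow> gen_subgroup G \<subseteq> R"
proof
  fix x assume "G \<subseteq> R" "x \<in> gen_subgroup G"
  then show "x \<in> R"
    by (induction rule: gen_subgroup.induct[OF \<open>x \<in> gen_subgroup G\<close>])
      (auto intro: zero_closed diff_closed)
qed

lemma gen_subgroup_ideal:
  assumes GR: "G \<subseteq> R" and G: "\<And>g r. g \<in> G \<Longrightarrow> r \<in> R \<Longrightarrow> p g r \<in> G \<and> p r g \<in> G"
  shows "r_ideal R p (gen_subgroup G)"
proof -
  have "p x r \<in> gen_subgroup G \<and> p r x \<in> gen_subgroup G" if "x \<in> gen_subgroup G" "r \<in> R" for x r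
    using that
  proof (induction x rule: gen_subgroup.induct)
    case zero
    then show ?case by (simp add: mult_zero_left mult_zero_right gen_subgroup.zero)
  next
    case (gen g)
    then show ?case using G by (blast intro: gen_subgroup.gen)
  next
    case (diff a b)
    then have "a \<in> R" "b \<in> R" using gen_subgroup_subset[OF GR] by auto
    with diff show ?case by (simp add: right_diff_distrib left_diff_distrib gen_subgroup.diff)
  qed
  then show ?thesis
    unfolding r_ideal_def using gen_subgroup_subset[OF GR] gen_subgroup.zero gen_subgroup.diff
    by blast
qed

lemma list_prod_closed: "set xs \<subseteq> R \<Longrightarrow> list_prod p xs \<in> R"
  by (cases xs) (auto intro: lprod_closed zero_closed)

lemma list_prod_diff:
  assumes "set us \<subseteq> R" "set vs \<subseteq> R" "a \<in> R" "b \<in> R"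
  shows "list_prod p (us @ (a - b) # vs) = list_prod p (us @ a # vs) - list_prod p (us @ b # vs)"
  using assms
proof (induction us)
  case Nil
  then show ?case
    by (cases vs) (simp_all add: left_diff_distrib lprod_closed)
next
  case (Cons u us)
  then show ?case
    by (simp add: list_prod_Cons right_diff_distrib list_prod_closed diff_closed
        del: list_prod.simps(2))
qed

lemma list_prod_gen_subgroup_eq_zero:
  assumes GR: "G \<subseteq> R"
    and nil: "\<And>x xs. x \<in> G \<Longrightarrow> set xs \<subseteq> G \<Longrightarrow> length xs = n \<Longrightarrow> lprod p x xs = 0"
    and us: "set us \<subseteq> gen_subgroup G" and vs: "set vs \<subseteq> G"
    and len: "length us + length vs = Suc n"
  shows "list_prod p (us @ vs) = 0"
  using us vs len
proof (induction us arbitrary: vs rule: rev_induct)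
  case Nil
  then obtain x xs where "vs = x # xs" "length xs = n" by (cases vs) auto
  with Nil.prems(2) show ?case using nil[of x xs] by simp
next
  case (snoc w us)
  have us: "set us \<subseteq> gen_subgroup G" and w: "w \<in> gen_subgroup G"
    using snoc.prems(1) by auto
  have usR: "set us \<subseteq> R" using us gen_subgroup_subset[OF GR] by blast
  have vsR: "set vs \<subseteq> R" using snoc.prems(2) GR by blast
  from w have "list_prod p (us @ w # vs) = 0"
  proof (induction w rule: gen_subgroup.induct)
    case zero
    show ?case using list_prod_diff[OF usR vsR zero_closed zero_closed] by simp
  next
    case (gen g)
    have "set (g # vs) \<subseteq> G" using gen snoc.prems(2) by simp
    moreover have "length us + length (g # vs) = Suc n" using snoc.prems(3) by simp
    ultimately show ?case using snoc.IH[OF us] by simp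
  next
    case (diff a b)
    then have "a \<in> R" "b \<in> R" using gen_subgroup_subset[OF GR] by auto
    then show ?case using list_prod_diff[OF usR vsR] diff.IH by simp
  qed
  then show ?case by simp
qed

lemma loc_nilpotent_gen_subgroup:
  assumes GR: "G \<subseteq> R" and G: "r_loc_nilpotent p G"
  shows "r_loc_nilpotent p (gen_subgroup G)"
  unfolding r_loc_nilpotent_def
proof (intro allI impI)
  fix F assume F: "finite F \<and> F \<subseteq> gen_subgroup G"
  obtain G' where G': "finite G'" "G' \<subseteq> G" "F \<subseteq> gen_subgroup G'"
    using finite_subset_gen_subgroup[of F G] F by blast
  obtain n where "\<forall>x xs. x \<in> G' \<and> set xs \<subseteq> G' \<and> length xs = n \<longrightarrow> lprod p x xs = 0"
    using G[unfolded r_loc_nilpotent_def, rule_format, of G'] G'(1,2) by blast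
  then have n: "\<And>x xs. x \<in> G' \<Longrightarrow> set xs \<subseteq> G' \<Longrightarrow> length xs = n \<Longrightarrow> lprod p x xs = 0"
    by blast
  have G'R: "G' \<subseteq> R" using G'(2) GR by blast
  have "lprod p x xs = 0" if "x \<in> F" "set xs \<subseteq> F" "length xs = n" for x xs
  proof -
    have "list_prod p ((x # xs) @ []) = 0"
      by (rule list_prod_gen_subgroup_eq_zero[of G' n, OF G'R n]) (use that G'(3) in auto)
    then show ?thesis by simp
  qed
  then show "\<exists>n. \<forall>x xs. x \<in> F \<and> set xs \<subseteq> F \<and> length xs = n \<longrightarrow> lprod p x xs = 0"
    by blast
qed

lemma levitzki_ideal: "r_ideal R p (r_levitzki R p)"
  unfolding r_levitzki_def by (rule ideal_Inter) blast

lemma loc_nilpotent_ideal_subset_levitzki: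
  "r_ideal R p J \<Longrightarrow> r_loc_nilpotent p J \<Longrightarrow> J \<subseteq> r_levitzki R p"
  unfolding r_levitzki_def using r_ideal_subset by blast

lemma levitzki_subset_gen_subgroup:
  "r_levitzki R p \<subseteq> gen_subgroup (\<Union>{J. r_ideal R p J \<and> r_loc_nilpotent p J})"
proof -
  let ?G = "\<Union>{J. r_ideal R p J \<and> r_loc_nilpotent p J}"
  have "r_ideal R p (gen_subgroup ?G)"
    by (rule gen_subgroup_ideal) (auto dest: r_ideal_subset intro: r_ideal_mult_right r_ideal_mult_left)
  moreover have "J \<subseteq> gen_subgroup ?G" if "r_ideal R p J \<and> r_loc_nilpotent p J" for J
    using that by (auto intro: gen_subgroup.gen)
  ultimately show ?thesis unfolding r_levitzki_def by blast
qed

end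

fun lmult_opt :: "('r \<Rightarrow> 'r \<Rightarrow> 'r) \<Rightarrow> 'r option \<Rightarrow> 'r \<Rightarrow> 'r" where
  "lmult_opt p None l = l"
| "lmult_opt p (Some a) l = p a l"

fun rmult_opt :: "('r \<Rightarrow> 'r \<Rightarrow> 'r) \<Rightarrow> 'r \<Rightarrow> 'r option \<Rightarrow> 'r" where
  "rmult_opt p l None = l"
| "rmult_opt p l (Some a) = p l a"

text \<open>\<open>regroup p l\<^sub>0 [(a\<^sub>1, l\<^sub>1), \<dots>, (a\<^sub>n, l\<^sub>n)] = [l\<^sub>0 a\<^sub>1, \<dots>, l\<^sub>n\<^sub>-\<^sub>1 a\<^sub>n, l\<^sub>n]\<close>, the factors of
  \<open>(a\<^sub>0 l\<^sub>0) (a\<^sub>1 l\<^sub>1) \<dots> (a\<^sub>n l\<^sub>n) = a\<^sub>0 (l\<^sub>0 a\<^sub>1) \<dots> (l\<^sub>n\<^sub>-\<^sub>1 a\<^sub>n) l\<^sub>n\<close>; an absent (\<open>None\<close>) factor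
  \<open>a\<^sub>k\<close> is omitted.\<close>
fun regroup :: "('r \<Rightarrow> 'r \<Rightarrow> 'r) \<Rightarrow> 'r \<Rightarrow> ('r option \<times> 'r) list \<Rightarrow> 'r list" where
  "regroup p l [] = [l]"
| "regroup p l ((a, l') # qs) = rmult_opt p l a # regroup p l' qs"

lemma length_regroup: "length (regroup p l qs) = Suc (length qs)"
  by (induction qs arbitrary: l) auto

lemma set_regroup_subset:
  assumes "l \<in> snd ` Q" "set qs \<subseteq> Q"
  shows "set (regroup p l qs) \<subseteq> (\<lambda>(q, q'). rmult_opt p (snd q) (fst q')) ` (Q \<times> Q) \<union> snd ` Q"
  using assms
proof (induction qs arbitrary: l)
  case (Cons q qs)
  then obtain q0 where "q0 \<in> Q" "l = snd q0" "q \<in> Q" by auto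
  then have "rmult_opt p l (fst q) \<in> (\<lambda>(q, q'). rmult_opt p (snd q) (fst q')) ` (Q \<times> Q)" by force
  moreover have "set (regroup p (snd q) qs) \<subseteq> (\<lambda>(q, q'). rmult_opt p (snd q) (fst q')) ` (Q \<times> Q) \<union> snd ` Q"
    using Cons.IH \<open>q \<in> Q\<close> Cons.prems(2) by auto
  ultimately show ?case by (cases q) auto
qed simp

context rng
begin

lemma rmult_opt_closed: "set_option a \<subseteq> R \<Longrightarrow> l \<in> R \<Longrightarrow> rmult_opt p l a \<in> R"
  by (cases a) (auto intro: mult_closed)

lemma rmult_opt_right_ideal: "r_right_ideal R p L \<Longrightarrow> set_option a \<subseteq> R \<Longrightarrow> l \<in> L \<Longrightarrow> rmult_opt p l a \<in> L"
  by (cases a) (auto intro: r_right_ideal_mult)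

lemma regroup_closed:
  "l \<in> R \<Longrightarrow> \<forall>(a, l')\<in>set qs. set_option a \<subseteq> R \<and> l' \<in> R \<Longrightarrow> set (regroup p l qs) \<subseteq> R"
proof (induction qs arbitrary: l)
  case (Cons q qs)
  then show ?case by (cases q) (simp add: rmult_opt_closed)
qed simp

lemma lprod_regroup:
  assumes "set_option a \<subseteq> R" "l \<in> R" "\<forall>(a, l')\<in>set qs. set_option a \<subseteq> R \<and> l' \<in> R"
  shows "lprod p (lmult_opt p a l) (map (\<lambda>(a, l). lmult_opt p a l) qs)
    = lmult_opt p a (list_prod p (regroup p l qs))"
  using assms
proof (induction qs arbitrary: a l)
  case Nil
  then show ?case by simp
next
  case (Cons q qs)
  obtain a' l' where q: "q = (a', l')" by force
  with Cons.prems have a': "set_option a' \<subseteq> R" and l': "l' \<in> R"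
    and qs: "\<forall>(a, l')\<in>set qs. set_option a \<subseteq> R \<and> l' \<in> R" by auto
  define W where "W = list_prod p (regroup p l' qs)"
  have W: "W \<in> R" unfolding W_def using list_prod_closed regroup_closed[OF l' qs] by blast
  have "p (lmult_opt p a l) (lmult_opt p a' W) = lmult_opt p a (p (rmult_opt p l a') W)"
    using Cons.prems(1,2) a' W by (cases a; cases a') (auto simp: assoc mult_closed)
  moreover have "regroup p l' qs \<noteq> []" by (cases qs) auto
  ultimately show ?case
    using Cons.IH[OF a' l' qs] q by (simp add: W_def list_prod_Cons del: list_prod.simps(2))
qed

lemma left_multiples_subset_lmult_opt:
  "L \<subseteq> R \<Longrightarrow> L \<union> {p a l |a l. a \<in> R \<and> l \<in> L}
    \<subseteq> (\<lambda>(a, l). lmult_opt p a l) ` ({a. set_option a \<subseteq> R} \<times> L)"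
  by (auto intro: rev_image_eqI[of "(None, l)" for l] rev_image_eqI[of "(Some a, l)" for a l])

lemma loc_nilpotent_left_multiples:
  assumes L: "r_right_ideal R p L" and Ln: "r_loc_nilpotent p L"
  shows "r_loc_nilpotent p (L \<union> {p a l |a l. a \<in> R \<and> l \<in> L})"
  unfolding r_loc_nilpotent_def
proof (intro allI impI)
  fix F assume F: "finite F \<and> F \<subseteq> L \<union> {p a l |a l. a \<in> R \<and> l \<in> L}"
  have LR: "L \<subseteq> R" using r_right_ideal_subset[OF L] .
  obtain Q where Q: "Q \<subseteq> {a. set_option a \<subseteq> R} \<times> L" "finite Q" "F = (\<lambda>(a, l). lmult_opt p a l) ` Q"
    using finite_subset_image[of F] F left_multiples_subset_lmult_opt[OF LR] by (meson order_trans)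
  define F' where "F' = (\<lambda>(q, q'). rmult_opt p (snd q) (fst q')) ` (Q \<times> Q) \<union> snd ` Q"
  have "finite F'" unfolding F'_def using Q(2) by simp
  moreover have "F' \<subseteq> L"
    unfolding F'_def by (fastforce dest: subsetD[OF Q(1)] intro: rmult_opt_right_ideal[OF L])
  ultimately obtain n where "\<forall>x xs. x \<in> F' \<and> set xs \<subseteq> F' \<and> length xs = n \<longrightarrow> lprod p x xs = 0"
    using Ln[unfolded r_loc_nilpotent_def, rule_format, of F'] by blast
  then have n: "\<And>xs. set xs \<subseteq> F' \<Longrightarrow> length xs = Suc n \<Longrightarrow> list_prod p xs = 0"
    by (auto simp: length_Suc_conv)
  have "lprod p x xs = 0" if x: "x \<in> F" and xs: "set xs \<subseteq> F" "length xs = n" for x xs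
  proof -
    obtain a l where q: "(a, l) \<in> Q" "x = lmult_opt p a l" using x Q(3) by auto
    have "xs \<in> lists ((\<lambda>(a, l). lmult_opt p a l) ` Q)" using xs(1) Q(3) by auto
    then obtain qs where qs: "set qs \<subseteq> Q" "xs = map (\<lambda>(a, l). lmult_opt p a l) qs"
      unfolding lists_image by auto
    have QR: "\<forall>(a, l')\<in>set qs. set_option a \<subseteq> R \<and> l' \<in> R" using qs(1) Q(1) LR by auto
    have "lprod p x xs = lmult_opt p a (list_prod p (regroup p l qs))"
      using lprod_regroup[of a l qs] q Q(1) QR LR qs(2) by auto
    also have "list_prod p (regroup p l qs) = 0"
    proof (rule n)
      show "set (regroup p l qs) \<subseteq> F'"
        unfolding F'_def by (rule set_regroup_subset) (use q qs(1) in force)+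
    qed (use xs(2) qs(2) in \<open>simp add: length_regroup\<close>)
    finally show ?thesis using q Q(1) by (cases a) (auto simp: mult_zero_right)
  qed
  then show "\<exists>n. \<forall>x xs. x \<in> F \<and> set xs \<subseteq> F \<and> length xs = n \<longrightarrow> lprod p x xs = 0"
    by blast
qed

lemma loc_nilpotent_right_ideal_subset_levitzki:
  assumes L: "r_right_ideal R p L" and Ln: "r_loc_nilpotent p L"
  shows "L \<subseteq> r_levitzki R p"
proof -
  define G where "G = L \<union> {p a l |a l. a \<in> R \<and> l \<in> L}"
  have LR: "L \<subseteq> R" using r_right_ideal_subset[OF L] .
  have GR: "G \<subseteq> R" unfolding G_def using LR mult_closed by blast
  have "p g r \<in> G \<and> p r g \<in> G" if g: "g \<in> G" and r: "r \<in> R" for g r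
  proof (cases "g \<in> L")
    case True
    then show ?thesis unfolding G_def using r_right_ideal_mult[OF L] r by blast
  next
    case False
    then obtain a l where al: "g = p a l" "a \<in> R" "l \<in> L" using g unfolding G_def by blast
    then have "p g r = p a (p l r)" "p r g = p (p r a) l"
      using LR r by (auto simp: assoc)
    then show ?thesis
      unfolding G_def using al r r_right_ideal_mult[OF L] mult_closed by blast
  qed
  then have "r_ideal R p (gen_subgroup G)" by (rule gen_subgroup_ideal[OF GR])
  moreover have "r_loc_nilpotent p (gen_subgroup G)"
    using loc_nilpotent_gen_subgroup[OF GR] loc_nilpotent_left_multiples[OF L Ln] G_def by blast
  ultimately have "gen_subgroup G \<subseteq> r_levitzki R p"
    by (rule loc_nilpotent_ideal_subset_levitzki)
  moreover have "L \<subseteq> gen_subgroup G" unfolding G_def by (auto intro: gen_subgroup.gen)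
  ultimately show ?thesis by blast
qed

end

section \<open>Gamma-rings\<close>

lemma g_ideal_subset: "g_ideal M G t J \<Longrightarrow> J \<subseteq> M"
  unfolding g_ideal_def by blast

lemma g_ideal_zero: "g_ideal M G t J \<Longrightarrow> 0 \<in> J"
  unfolding g_ideal_def by blast

lemma g_ideal_diff: "g_ideal M G t J \<Longrightarrow> x \<in> J \<Longrightarrow> y \<in> J \<Longrightarrow> x - y \<in> J"
  unfolding g_ideal_def by blast

lemma g_ideal_tern_right: "g_ideal M G t J \<Longrightarrow> x \<in> J \<Longrightarrow> g \<in> G \<Longrightarrow> m \<in> M \<Longrightarrow> t x g m \<in> J"
  unfolding g_ideal_def by blast

lemma g_ideal_tern_left: "g_ideal M G t J \<Longrightarrow> x \<in> J \<Longrightarrow> g \<in> G \<Longrightarrow> m \<in> M \<Longrightarrow> t m g x \<in> J"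
  unfolding g_ideal_def by blast

lemma g_ideal_sum: "g_ideal M G t J \<Longrightarrow> (\<And>k. k \<in> K \<Longrightarrow> f k \<in> J) \<Longrightarrow> sum f K \<in> J"
  by (rule subgroup_sum_mem) (auto intro: g_ideal_zero g_ideal_diff)

lemma g_levitzki_subset: "g_levitzki M G t \<subseteq> M"
  unfolding g_levitzki_def by blast

lemma g_jacobson_subset: "g_jacobson M G t \<subseteq> M"
  unfolding g_jacobson_def by blast

lemma loc_nilpotent_g_ideal_subset_g_levitzki:
  "g_ideal M G t N \<Longrightarrow> g_loc_nilpotent G t N \<Longrightarrow> N \<subseteq> g_levitzki M G t"
  unfolding g_levitzki_def using g_ideal_subset by blast

lemma g_levitzki_least:
  "g_ideal M G t Q \<Longrightarrow> (\<And>N. g_ideal M G t N \<Longrightarrow> g_loc_nilpotent G t N \<Longrightarrow> N \<subseteq> Q)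
    \<Longrightarrow> g_levitzki M G t \<subseteq> Q"
  unfolding g_levitzki_def by blast

lemma rqr_g_ideal_subset_g_jacobson:
  "g_ideal M G t N \<Longrightarrow> (\<forall>x\<in>N. g_rqr M G t x) \<Longrightarrow> N \<subseteq> g_jacobson M G t"
  unfolding g_jacobson_def using g_ideal_subset by blast

lemma g_jacobson_least:
  "g_ideal M G t Q \<Longrightarrow> (\<And>N. g_ideal M G t N \<Longrightarrow> (\<forall>x\<in>N. g_rqr M G t x) \<Longrightarrow> N \<subseteq> Q)
    \<Longrightarrow> g_jacobson M G t \<subseteq> Q"
  unfolding g_jacobson_def by blast

locale gamma_ring =
  fixes M :: "'m::ab_group_add set" and G :: "'g set" and t :: "'m \<Rightarrow> 'g \<Rightarrow> 'm \<Rightarrow> 'm"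
  assumes zero_closed: "0 \<in> M"
    and diff_closed: "x \<in> M \<Longrightarrow> y \<in> M \<Longrightarrow> x - y \<in> M"
    and tern_closed: "x \<in> M \<Longrightarrow> g \<in> G \<Longrightarrow> y \<in> M \<Longrightarrow> t x g y \<in> M"
    and tern_diff_left:
      "x \<in> M \<Longrightarrow> x' \<in> M \<Longrightarrow> g \<in> G \<Longrightarrow> y \<in> M \<Longrightarrow> t (x - x') g y = t x g y - t x' g y"
    and tern_diff_right:
      "x \<in> M \<Longrightarrow> g \<in> G \<Longrightarrow> y \<in> M \<Longrightarrow> y' \<in> M \<Longrightarrow> t x g (y - y') = t x g y - t x g y'"
    and tern_assoc: "x \<in> M \<Longrightarrow> g \<in> G \<Longrightarrow> y \<in> M \<Longrightarrow> h \<in> G \<Longrightarrow> z \<in> M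
      \<Longrightarrow> t (t x g y) h z = t x g (t y h z)"
begin

lemma tern_zero_left: "g \<in> G \<Longrightarrow> y \<in> M \<Longrightarrow> t 0 g y = 0"
  using tern_diff_left[of 0 0 g y] zero_closed by simp

lemma tern_zero_right: "x \<in> M \<Longrightarrow> g \<in> G \<Longrightarrow> t x g 0 = 0"
  using tern_diff_right[of x g 0 0] zero_closed by simp

lemma carrier_g_ideal: "g_ideal M G t M"
  unfolding g_ideal_def using zero_closed diff_closed tern_closed by blast

lemma g_ideal_Inter: "(\<And>K. K \<in> F \<Longrightarrow> g_ideal M G t K) \<Longrightarrow> g_ideal M G t (M \<inter> \<Inter> F)"
  unfolding g_ideal_def using zero_closed diff_closed tern_closed by blast

lemma g_levitzki_g_ideal: "g_ideal M G t (g_levitzki M G t)"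
  unfolding g_levitzki_def by (rule g_ideal_Inter) blast

lemma g_ideal_left_annihilator_mod:
  assumes Q: "g_ideal M G t Q"
  shows "g_ideal M G t {w \<in> M. \<forall>g\<in>G. \<forall>m\<in>M. t w g m \<in> Q}" (is "g_ideal M G t ?W")
  unfolding g_ideal_def
proof (intro conjI ballI)
  show "0 \<in> ?W" using zero_closed tern_zero_left g_ideal_zero[OF Q] by auto
next
  fix x y assume x: "x \<in> ?W" and y: "y \<in> ?W"
  have "t (x - y) g m \<in> Q" if "g \<in> G" "m \<in> M" for g m
    using x y that tern_diff_left g_ideal_diff[OF Q] by auto
  then show "x - y \<in> ?W" using x y diff_closed by blast
next
  fix x g m assume x: "x \<in> ?W" and g: "g \<in> G" and m: "m \<in> M"
  have "t (t x g m) g' m' \<in> Q" if "g' \<in> G" "m' \<in> M" for g' m'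
    using x g m that tern_assoc tern_closed by auto
  then show "t x g m \<in> ?W" using x g m tern_closed by blast
  have "t (t m g x) g' m' \<in> Q" if "g' \<in> G" "m' \<in> M" for g' m'
    using x g m that tern_assoc g_ideal_tern_left[OF Q] by auto
  then show "t m g x \<in> ?W" using x g m tern_closed by blast
qed blast

lemma g_ideal_right_annihilator_mod:
  assumes Q: "g_ideal M G t Q"
  shows "g_ideal M G t {w \<in> M. \<forall>m\<in>M. \<forall>g\<in>G. t m g w \<in> Q}" (is "g_ideal M G t ?V")
  unfolding g_ideal_def
proof (intro conjI ballI)
  show "0 \<in> ?V" using zero_closed tern_zero_right g_ideal_zero[OF Q] by auto
next
  fix x y assume x: "x \<in> ?V" and y: "y \<in> ?V"
  have "t m g (x - y) \<in> Q" if "m \<in> M" "g \<in> G" for g m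
    using x y that tern_diff_right g_ideal_diff[OF Q] by auto
  then show "x - y \<in> ?V" using x y diff_closed by blast
next
  fix x g m assume x: "x \<in> ?V" and g: "g \<in> G" and m: "m \<in> M"
  have "t m' g' (t x g m) \<in> Q" if "m' \<in> M" "g' \<in> G" for g' m'
    using x g m that tern_assoc[symmetric] g_ideal_tern_right[OF Q] by auto
  then show "t x g m \<in> ?V" using x g m tern_closed by blast
  have "t m' g' (t m g x) \<in> Q" if "m' \<in> M" "g' \<in> G" for g' m'
    using x g m that tern_assoc[symmetric] tern_closed by auto
  then show "t m g x \<in> ?V" using x g m tern_closed by blast
qed blast

lemma g_prime_ideal_sandwich:
  assumes Q: "g_prime_ideal M G t Q" and s: "s \<in> M"
    and MsM: "\<And>m g g' m'. m \<in> M \<Longrightarrow> g \<in> G \<Longrightarrow> g' \<in> G \<Longrightarrow> m' \<in> M \<Longrightarrow> t (t m g s) g' m' \<in> Q"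
  shows "s \<in> Q"
proof -
  have Qi: "g_ideal M G t Q" and QM: "Q \<noteq> M"
    and prime: "\<And>X Y. g_ideal M G t X \<Longrightarrow> g_ideal M G t Y
      \<Longrightarrow> (\<forall>x\<in>X. \<forall>g\<in>G. \<forall>y\<in>Y. t x g y \<in> Q) \<Longrightarrow> X \<subseteq> Q \<or> Y \<subseteq> Q"
    using Q unfolding g_prime_ideal_def by blast+
  have M_not_Q: "\<not> M \<subseteq> Q" using QM g_ideal_subset[OF Qi] by blast
  let ?W = "{w \<in> M. \<forall>g\<in>G. \<forall>m\<in>M. t w g m \<in> Q}"
  have "?W \<subseteq> Q \<or> M \<subseteq> Q"
    by (rule prime[OF g_ideal_left_annihilator_mod[OF Qi] carrier_g_ideal]) blast
  then have W: "?W \<subseteq> Q" using M_not_Q by blast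
  let ?V = "{w \<in> M. \<forall>m\<in>M. \<forall>g\<in>G. t m g w \<in> Q}"
  have "M \<subseteq> Q \<or> ?V \<subseteq> Q"
    by (rule prime[OF carrier_g_ideal g_ideal_right_annihilator_mod[OF Qi]]) blast
  then have V: "?V \<subseteq> Q" using M_not_Q by blast
  have "t m g s \<in> Q" if "m \<in> M" "g \<in> G" for m g
  proof -
    have "t m g s \<in> M" using that s tern_closed by blast
    moreover have "\<forall>g'\<in>G. \<forall>m'\<in>M. t (t m g s) g' m' \<in> Q" using MsM that by blast
    ultimately show ?thesis using W by blast
  qed
  then have "s \<in> ?V" using s by blast
  then show ?thesis using V by blast
qed

lemma gprod_closed: "x \<in> M \<Longrightarrow> set ys \<subseteq> G \<times> M \<Longrightarrow> gprod t x ys \<in> M"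
proof (induction ys arbitrary: x)
  case (Cons q ys)
  then show ?case by (cases q) (auto intro: tern_closed)
qed simp

end

section \<open>Generalized matrix rings\<close>

definition supp :: "('i \<Rightarrow> 'i \<Rightarrow> 'a::zero) \<Rightarrow> ('i \<times> 'i) set" where
  "supp x = {(i, j). x i j \<noteq> 0}"

definition col_supp :: "('i \<Rightarrow> 'i \<Rightarrow> 'a::zero) \<Rightarrow> 'i set" where
  "col_supp x = {k. \<exists>i. x i k \<noteq> 0}"

definition single :: "'i \<Rightarrow> 'i \<Rightarrow> 'a::zero \<Rightarrow> ('i \<Rightarrow> 'i \<Rightarrow> 'a)" where
  "single i j a = (\<lambda>k l. if k = i \<and> l = j then a else 0)"

lemma single_zero [simp]: "single i j 0 = 0"
  unfolding single_def by (auto simp: fun_eq_iff)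

lemma single_same [simp]: "single i j a i j = a"
  unfolding single_def by simp

lemma single_diff: "single i j (a::'a::ab_group_add) - single i j b = single i j (a - b)"
  unfolding single_def by (auto simp: fun_eq_iff)

locale generalized_matrix_ring =
  fixes I :: "'i set" and C :: "'i \<Rightarrow> 'i \<Rightarrow> 'a::ab_group_add set"
    and mu :: "'i \<Rightarrow> 'i \<Rightarrow> 'i \<Rightarrow> 'a \<Rightarrow> 'a \<Rightarrow> 'a"
  assumes gm: "gm_ring I C mu"
begin

abbreviation "A \<equiv> gm_carrier I C"
abbreviation "mulA \<equiv> gm_mult I mu"
abbreviation "tern \<equiv> gm_tern mu"

lemma comp_zero: "i \<in> I \<Longrightarrow> j \<in> I \<Longrightarrow> 0 \<in> C i j"
  using gm unfolding gm_ring_def by (elim conjE) meson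

lemma comp_diff: "i \<in> I \<Longrightarrow> j \<in> I \<Longrightarrow> x \<in> C i j \<Longrightarrow> y \<in> C i j \<Longrightarrow> x - y \<in> C i j"
  using gm unfolding gm_ring_def by (elim conjE) meson

lemma comp_neg: "i \<in> I \<Longrightarrow> j \<in> I \<Longrightarrow> y \<in> C i j \<Longrightarrow> - y \<in> C i j"
  using comp_diff[of i j 0 y] comp_zero by simp

lemma comp_add: "i \<in> I \<Longrightarrow> j \<in> I \<Longrightarrow> x \<in> C i j \<Longrightarrow> y \<in> C i j \<Longrightarrow> x + y \<in> C i j"
  using comp_diff[of i j x "- y"] comp_neg by simp

lemma comp_sum: "i \<in> I \<Longrightarrow> j \<in> I \<Longrightarrow> (\<And>k. k \<in> K \<Longrightarrow> f k \<in> C i j) \<Longrightarrow> sum f K \<in> C i j"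
  by (rule subgroup_sum_mem) (auto intro: comp_zero comp_diff)

lemma mu_closed:
  "i \<in> I \<Longrightarrow> j \<in> I \<Longrightarrow> l \<in> I \<Longrightarrow> x \<in> C i j \<Longrightarrow> y \<in> C j l \<Longrightarrow> mu i j l x y \<in> C i l"
  using gm unfolding gm_ring_def by (elim conjE) meson

lemma mu_add_left: "i \<in> I \<Longrightarrow> j \<in> I \<Longrightarrow> l \<in> I \<Longrightarrow> x \<in> C i j \<Longrightarrow> x' \<in> C i j \<Longrightarrow> y \<in> C j l \<Longrightarrow>
    mu i j l (x + x') y = mu i j l x y + mu i j l x' y"
  using gm unfolding gm_ring_def by (elim conjE) meson

lemma mu_add_right: "i \<in> I \<Longrightarrow> j \<in> I \<Longrightarrow> l \<in> I \<Longrightarrow> x \<in> C i j \<Longrightarrow> y \<in> C j l \<Longrightarrow> y' \<in> C j l \<Longrightarrow>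
    mu i j l x (y + y') = mu i j l x y + mu i j l x y'"
  using gm unfolding gm_ring_def by (elim conjE) meson

lemma mu_assoc: "i \<in> I \<Longrightarrow> j \<in> I \<Longrightarrow> k \<in> I \<Longrightarrow> l \<in> I \<Longrightarrow>
    x \<in> C i j \<Longrightarrow> y \<in> C j k \<Longrightarrow> z \<in> C k l \<Longrightarrow>
    mu i k l (mu i j k x y) z = mu i j l x (mu j k l y z)"
  using gm unfolding gm_ring_def by (elim conjE) meson

lemma mu_zero_left: "i \<in> I \<Longrightarrow> j \<in> I \<Longrightarrow> l \<in> I \<Longrightarrow> y \<in> C j l \<Longrightarrow> mu i j l 0 y = 0"
  using mu_add_left[of i j l 0 0 y] comp_zero by simp

lemma mu_zero_right: "i \<in> I \<Longrightarrow> j \<in> I \<Longrightarrow> l \<in> I \<Longrightarrow> x \<in> C i j \<Longrightarrow> mu i j l x 0 = 0"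
  using mu_add_right[of i j l x 0 0] comp_zero by simp

lemma mu_diff_left: "i \<in> I \<Longrightarrow> j \<in> I \<Longrightarrow> l \<in> I \<Longrightarrow> x \<in> C i j \<Longrightarrow> x' \<in> C i j \<Longrightarrow> y \<in> C j l \<Longrightarrow>
    mu i j l (x - x') y = mu i j l x y - mu i j l x' y"
  using mu_add_left[of i j l "x - x'" x' y] comp_diff by (simp add: algebra_simps)

lemma mu_diff_right: "i \<in> I \<Longrightarrow> j \<in> I \<Longrightarrow> l \<in> I \<Longrightarrow> x \<in> C i j \<Longrightarrow> y \<in> C j l \<Longrightarrow> y' \<in> C j l \<Longrightarrow>
    mu i j l x (y - y') = mu i j l x y - mu i j l x y'"
  using mu_add_right[of i j l x "y - y'" y'] comp_diff by (simp add: algebra_simps)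

lemma mu_sum_left: "i \<in> I \<Longrightarrow> j \<in> I \<Longrightarrow> l \<in> I \<Longrightarrow> (\<And>k. k \<in> K \<Longrightarrow> f k \<in> C i j) \<Longrightarrow> y \<in> C j l \<Longrightarrow>
    mu i j l (sum f K) y = (\<Sum>k\<in>K. mu i j l (f k) y)"
  by (induction K rule: infinite_finite_induct) (simp_all add: mu_zero_left mu_add_left comp_sum)

lemma mu_sum_right: "i \<in> I \<Longrightarrow> j \<in> I \<Longrightarrow> l \<in> I \<Longrightarrow> (\<And>k. k \<in> K \<Longrightarrow> f k \<in> C j l) \<Longrightarrow> x \<in> C i j \<Longrightarrow>
    mu i j l x (sum f K) = (\<Sum>k\<in>K. mu i j l x (f k))"
  by (induction K rule: infinite_finite_induct) (simp_all add: mu_zero_right mu_add_right comp_sum)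

lemma comp_rng: "i \<in> I \<Longrightarrow> rng (C i i) (mu i i i)"
  by unfold_locales (auto intro: comp_zero comp_diff mu_closed mu_add_left mu_add_right mu_assoc)

lemma tern_eq: "tern i j x g y = mu i i j (mu i j i x g) y"
  unfolding gm_tern_def ..

lemma comp_gamma_ring: "i \<in> I \<Longrightarrow> j \<in> I \<Longrightarrow> gamma_ring (C i j) (C j i) (tern i j)"
  by unfold_locales (simp_all add: tern_eq comp_zero comp_diff mu_closed mu_diff_left mu_diff_right mu_assoc)

lemma carrier_entry: "x \<in> A \<Longrightarrow> i \<in> I \<Longrightarrow> j \<in> I \<Longrightarrow> x i j \<in> C i j"
  unfolding gm_carrier_def by (metis (mono_tags, lifting) mem_Collect_eq)

lemma carrier_outside: "x \<in> A \<Longrightarrow> \<not> (i \<in> I \<and> j \<in> I) \<Longrightarrow> x i j = 0"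
  unfolding gm_carrier_def by (metis (mono_tags, lifting) mem_Collect_eq singletonD)

lemma finite_supp: "x \<in> A \<Longrightarrow> finite (supp x)"
  unfolding gm_carrier_def supp_def by blast

lemma carrierI:
  "(\<And>i j. i \<in> I \<Longrightarrow> j \<in> I \<Longrightarrow> x i j \<in> C i j) \<Longrightarrow> (\<And>i j. \<not> (i \<in> I \<and> j \<in> I) \<Longrightarrow> x i j = 0)
    \<Longrightarrow> finite (supp x) \<Longrightarrow> x \<in> A"
  unfolding gm_carrier_def supp_def by auto

lemma finite_col_supp: "x \<in> A \<Longrightarrow> finite (col_supp x)"
proof -
  assume "x \<in> A"
  moreover have "col_supp x = snd ` supp x" unfolding col_supp_def supp_def by force
  ultimately show ?thesis using finite_supp by simp
qed

lemma col_supp_subset: "x \<in> A \<Longrightarrow> col_supp x \<subseteq> I"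
  unfolding col_supp_def using carrier_outside by blast

lemma mult_outside: "\<not> (i \<in> I \<and> j \<in> I) \<Longrightarrow> mulA x y i j = 0"
  unfolding gm_mult_def by auto

lemma mult_entry:
  assumes x: "x \<in> A" and y: "y \<in> A" and K: "finite K" "K \<subseteq> I" "col_supp x \<subseteq> K"
    and ij: "i \<in> I" "j \<in> I"
  shows "mulA x y i j = (\<Sum>k\<in>K. mu i k j (x i k) (y k j))"
proof -
  have "mulA x y i j = (\<Sum>k\<in>{k\<in>I. x i k \<noteq> 0}. mu i k j (x i k) (y k j))"
    unfolding gm_mult_def using ij by simp
  also have "\<dots> = (\<Sum>k\<in>K. mu i k j (x i k) (y k j))"
  proof (rule sum.mono_neutral_left)
    show "{k \<in> I. x i k \<noteq> 0} \<subseteq> K" using K(3) unfolding col_supp_def by blast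
    show "\<forall>k\<in>K - {k \<in> I. x i k \<noteq> 0}. mu i k j (x i k) (y k j) = 0"
      using K(2) ij mu_zero_left carrier_entry[OF y] by auto
  qed (rule K(1))
  finally show ?thesis .
qed

lemma mult_entry_col_supp:
  "x \<in> A \<Longrightarrow> y \<in> A \<Longrightarrow> i \<in> I \<Longrightarrow> j \<in> I \<Longrightarrow>
    mulA x y i j = (\<Sum>k\<in>col_supp x. mu i k j (x i k) (y k j))"
  by (rule mult_entry) (auto simp: finite_col_supp col_supp_subset)

lemma carrier_zero: "0 \<in> A"
  by (rule carrierI) (auto simp: comp_zero supp_def)

lemma carrier_diff: "x \<in> A \<Longrightarrow> y \<in> A \<Longrightarrow> x - y \<in> A"
proof (rule carrierI)
  assume "x \<in> A" "y \<in> A"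
  moreover have "supp (x - y) \<subseteq> supp x \<union> supp y" unfolding supp_def by auto
  ultimately show "finite (supp (x - y))" by (meson finite_supp finite_UnI finite_subset)
qed (auto simp: carrier_entry comp_diff carrier_outside)

lemma carrier_add: "x \<in> A \<Longrightarrow> y \<in> A \<Longrightarrow> x + y \<in> A"
  using carrier_diff[of x "- y"] carrier_diff[of 0 y] carrier_zero by simp

lemma mult_closed:
  assumes x: "x \<in> A" and y: "y \<in> A"
  shows "mulA x y \<in> A"
proof (rule carrierI)
  fix i j assume ij: "i \<in> I" "j \<in> I"
  show "mulA x y i j \<in> C i j"
    unfolding mult_entry_col_supp[OF x y ij] using ij col_supp_subset[OF x]
    by (auto intro!: comp_sum mu_closed carrier_entry[OF x] carrier_entry[OF y])
next
  have "supp (mulA x y) \<subseteq> fst ` supp x \<times> col_supp y"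
  proof
    fix q assume q: "q \<in> supp (mulA x y)"
    then obtain i j where qij: "q = (i, j)" "mulA x y i j \<noteq> 0" unfolding supp_def by auto
    then have ij: "i \<in> I" "j \<in> I" using mult_outside by blast+
    with qij obtain k where k: "k \<in> col_supp x" "mu i k j (x i k) (y k j) \<noteq> 0"
      using mult_entry_col_supp[OF x y ij] by (metis (no_types, lifting) sum.neutral)
    with ij col_supp_subset[OF x] have "x i k \<noteq> 0" "y k j \<noteq> 0"
      using mu_zero_left mu_zero_right carrier_entry[OF x] carrier_entry[OF y] by auto
    then show "q \<in> fst ` supp x \<times> col_supp y" unfolding qij supp_def col_supp_def by force
  qed
  moreover have "finite (fst ` supp x \<times> col_supp y)" using finite_supp[OF x] finite_col_supp[OF y] by simp
  ultimately show "finite (supp (mulA x y))" by (rule finite_subset)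
qed (rule mult_outside)

lemma mult_distrib_right:
  assumes x: "x \<in> A" and y: "y \<in> A" and z: "z \<in> A"
  shows "mulA (x + y) z = mulA x z + mulA y z"
proof (intro ext)
  fix i j
  show "mulA (x + y) z i j = (mulA x z + mulA y z) i j"
  proof (cases "i \<in> I \<and> j \<in> I")
    case True
    let ?K = "col_supp x \<union> col_supp y"
    have K: "finite ?K" "?K \<subseteq> I" using finite_col_supp col_supp_subset x y by auto
    have "col_supp (x + y) \<subseteq> ?K" unfolding col_supp_def by auto
    then have "mulA (x + y) z i j = (\<Sum>k\<in>?K. mu i k j ((x + y) i k) (z k j))"
      using mult_entry[OF carrier_add[OF x y] z K] True by blast
    also have "\<dots> = (\<Sum>k\<in>?K. mu i k j (x i k) (z k j) + mu i k j (y i k) (z k j))"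
      using True K by (intro sum.cong) (auto intro!: mu_add_left carrier_entry x y z)
    also have "\<dots> = mulA x z i j + mulA y z i j"
      using mult_entry[OF x z K] mult_entry[OF y z K] True by (simp add: sum.distrib)
    finally show ?thesis by simp
  qed (simp add: mult_outside)
qed

lemma mult_distrib_left:
  assumes x: "x \<in> A" and y: "y \<in> A" and z: "z \<in> A"
  shows "mulA x (y + z) = mulA x y + mulA x z"
proof (intro ext)
  fix i j
  show "mulA x (y + z) i j = (mulA x y + mulA x z) i j"
  proof (cases "i \<in> I \<and> j \<in> I")
    case True
    have "mulA x (y + z) i j = (\<Sum>k\<in>col_supp x. mu i k j (x i k) ((y + z) k j))"
      using mult_entry_col_supp[OF x carrier_add[OF y z]] True by blast
    also have "\<dots> = (\<Sum>k\<in>col_supp x. mu i k j (x i k) (y k j) + mu i k j (x i k) (z k j))"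
      using True col_supp_subset[OF x]
      by (intro sum.cong) (auto intro!: mu_add_right carrier_entry x y z)
    also have "\<dots> = mulA x y i j + mulA x z i j"
      using True by (simp add: mult_entry_col_supp x y z sum.distrib)
    finally show ?thesis by simp
  qed (simp add: mult_outside)
qed

lemma mult_mult_entry_left:
  assumes x: "x \<in> A" and y: "y \<in> A" and z: "z \<in> A"
    and K: "finite K" "K \<subseteq> I" "col_supp x \<subseteq> K" "col_supp (mulA x y) \<subseteq> K" and il: "i \<in> I" "l \<in> I"
  shows "mulA (mulA x y) z i l = (\<Sum>k\<in>K. \<Sum>m\<in>K. mu i m l (x i m) (mu m k l (y m k) (z k l)))"
proof -
  have "mulA (mulA x y) z i l = (\<Sum>k\<in>K. mu i k l (mulA x y i k) (z k l))"
    using mult_entry[OF mult_closed[OF x y] z K(1,2,4) il] .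
  also have "\<dots> = (\<Sum>k\<in>K. \<Sum>m\<in>K. mu i m l (x i m) (mu m k l (y m k) (z k l)))"
  proof (rule sum.cong[OF refl])
    fix k assume "k \<in> K"
    then have k: "k \<in> I" using K(2) by blast
    note entries = carrier_entry[OF x] carrier_entry[OF y] carrier_entry[OF z]
    have "mu i k l (mulA x y i k) (z k l) = (\<Sum>m\<in>K. mu i k l (mu i m k (x i m) (y m k)) (z k l))"
      unfolding mult_entry[OF x y K(1-3) il(1) k]
      using il k K(2) by (intro mu_sum_left) (auto intro!: mu_closed entries)
    also have "\<dots> = (\<Sum>m\<in>K. mu i m l (x i m) (mu m k l (y m k) (z k l)))"
      using il k K(2) by (intro sum.cong refl mu_assoc) (auto intro: entries)
    finally show "mu i k l (mulA x y i k) (z k l) = (\<Sum>m\<in>K. mu i m l (x i m) (mu m k l (y m k) (z k l)))" .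
  qed
  finally show ?thesis .
qed

lemma mult_mult_entry_right:
  assumes x: "x \<in> A" and y: "y \<in> A" and z: "z \<in> A"
    and K: "finite K" "K \<subseteq> I" "col_supp x \<subseteq> K" "col_supp y \<subseteq> K" and il: "i \<in> I" "l \<in> I"
  shows "mulA x (mulA y z) i l = (\<Sum>m\<in>K. \<Sum>k\<in>K. mu i m l (x i m) (mu m k l (y m k) (z k l)))"
proof -
  have "mulA x (mulA y z) i l = (\<Sum>m\<in>K. mu i m l (x i m) (mulA y z m l))"
    using mult_entry[OF x mult_closed[OF y z] K(1-3) il] .
  also have "\<dots> = (\<Sum>m\<in>K. \<Sum>k\<in>K. mu i m l (x i m) (mu m k l (y m k) (z k l)))"
  proof (rule sum.cong[OF refl])
    fix m assume "m \<in> K"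
    then have m: "m \<in> I" using K(2) by blast
    show "mu i m l (x i m) (mulA y z m l) = (\<Sum>k\<in>K. mu i m l (x i m) (mu m k l (y m k) (z k l)))"
      unfolding mult_entry[OF y z K(1,2,4) m il(2)] using il m K(2) carrier_entry x y z
      by (intro mu_sum_right) (auto intro!: mu_closed)
  qed
  finally show ?thesis .
qed

lemma mult_assoc:
  assumes x: "x \<in> A" and y: "y \<in> A" and z: "z \<in> A"
  shows "mulA (mulA x y) z = mulA x (mulA y z)"
proof (intro ext)
  fix i l
  show "mulA (mulA x y) z i l = mulA x (mulA y z) i l"
  proof (cases "i \<in> I \<and> l \<in> I")
    case True
    let ?K = "col_supp x \<union> col_supp y \<union> col_supp (mulA x y)"
    have K: "finite ?K" "?K \<subseteq> I"
      using finite_col_supp col_supp_subset x y mult_closed[OF x y] by auto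
    have "mulA (mulA x y) z i l = (\<Sum>k\<in>?K. \<Sum>m\<in>?K. mu i m l (x i m) (mu m k l (y m k) (z k l)))"
      by (rule mult_mult_entry_left[OF x y z K]) (use True in auto)
    also have "\<dots> = (\<Sum>m\<in>?K. \<Sum>k\<in>?K. mu i m l (x i m) (mu m k l (y m k) (z k l)))"
      by (rule sum.swap)
    also have "\<dots> = mulA x (mulA y z) i l"
      by (rule mult_mult_entry_right[OF x y z K, symmetric]) (use True in auto)
    finally show ?thesis .
  qed (simp add: mult_outside)
qed

lemma carrier_rng: "rng A mulA"
  by unfold_locales (auto intro: carrier_zero carrier_diff mult_closed mult_distrib_right
      mult_distrib_left mult_assoc)

sublocale A: rng A mulA
  by (rule carrier_rng)

lemma single_in_carrier: "i \<in> I \<Longrightarrow> j \<in> I \<Longrightarrow> a \<in> C i j \<Longrightarrow> single i j a \<in> A"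
proof (rule carrierI)
  show "finite (supp (single i j a))"
    by (rule finite_subset[of _ "{(i, j)}"]) (auto simp: supp_def single_def)
qed (auto simp: single_def comp_zero)

lemma mult_entry_single_index:
  assumes x: "x \<in> A" and y: "y \<in> A" and c: "c \<in> I" and rl: "r \<in> I" "l \<in> I"
    and vanish: "\<And>k. k \<in> I \<Longrightarrow> k \<noteq> c \<Longrightarrow> x r k = 0 \<or> y k l = 0"
  shows "mulA x y r l = mu r c l (x r c) (y c l)"
proof -
  let ?K = "insert c (col_supp x)"
  have K: "finite ?K" "?K \<subseteq> I" "col_supp x \<subseteq> ?K"
    using finite_col_supp[OF x] col_supp_subset[OF x] c by auto
  have "mulA x y r l = (\<Sum>k\<in>?K. mu r k l (x r k) (y k l))"
    by (rule mult_entry[OF x y K rl])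
  also have "\<dots> = mu r c l (x r c) (y c l) + (\<Sum>k\<in>?K - {c}. mu r k l (x r k) (y k l))"
    using K by (simp add: sum.insert_remove)
  also have "(\<Sum>k\<in>?K - {c}. mu r k l (x r k) (y k l)) = 0"
  proof (rule sum.neutral, rule ballI)
    fix k assume k: "k \<in> ?K - {c}"
    then have kI: "k \<in> I" using K by blast
    show "mu r k l (x r k) (y k l) = 0"
      using vanish[OF kI] k mu_zero_left[OF rl(1) kI rl(2) carrier_entry[OF y kI rl(2)]]
        mu_zero_right[OF rl(1) kI rl(2) carrier_entry[OF x rl(1) kI]] by auto
  qed
  finally show ?thesis by simp
qed

lemma mult_single_left:
  assumes ij: "i \<in> I" "j \<in> I" and a: "a \<in> C i j" and y: "y \<in> A"
  shows "mulA (single i j a) y k l = (if k = i \<and> l \<in> I then mu i j l a (y j l) else 0)"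
proof (cases "k \<in> I \<and> l \<in> I")
  case True
  have "mulA (single i j a) y k l = mu k j l (single i j a k j) (y j l)"
    by (rule mult_entry_single_index[OF single_in_carrier[OF ij a] y ij(2)])
      (use True in \<open>auto simp: single_def\<close>)
  then show ?thesis using True ij mu_zero_left carrier_entry[OF y] by (auto simp: single_def)
qed (use mult_outside ij in auto)

lemma mult_single_right:
  assumes jl: "j \<in> I" "l \<in> I" and b: "b \<in> C j l" and x: "x \<in> A"
  shows "mulA x (single j l b) k m = (if k \<in> I \<and> m = l then mu k j l (x k j) b else 0)"
proof (cases "k \<in> I \<and> m \<in> I")
  case True
  have "mulA x (single j l b) k m = mu k j m (x k j) (single j l b j m)"
    by (rule mult_entry_single_index[OF x single_in_carrier[OF jl b] jl(1)])
      (use True in \<open>auto simp: single_def\<close>)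
  then show ?thesis using True jl mu_zero_right carrier_entry[OF x] by (auto simp: single_def)
qed (use mult_outside jl in auto)

lemma single_mult_single:
  assumes "i \<in> I" "j \<in> I" "l \<in> I" "a \<in> C i j" "b \<in> C j l"
  shows "mulA (single i j a) (single j l b) = single i l (mu i j l a b)"
  using assms by (auto simp: fun_eq_iff mult_single_left single_in_carrier)
    (auto simp: single_def mu_zero_right)

lemma single_tern:
  "i \<in> I \<Longrightarrow> j \<in> I \<Longrightarrow> z \<in> C i j \<Longrightarrow> g \<in> C j i \<Longrightarrow> w \<in> C i j \<Longrightarrow>
    single i j (tern i j z g w) = mulA (mulA (single i j z) (single j i g)) (single i j w)"
  by (simp add: tern_eq single_mult_single mu_closed)

lemma mult_single_sandwich:
  assumes "i \<in> I" "k \<in> I" "l \<in> I" "j \<in> I" "u \<in> C i k" "v \<in> C l j" "x \<in> A"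
  shows "mulA (mulA (single i k u) x) (single l j v) = single i j (mu i l j (mu i k l u (x k l)) v)"
  using assms
  by (auto simp: fun_eq_iff mult_single_left mult_single_right single_in_carrier mult_closed)
    (auto simp: single_def mu_zero_left)

lemma mult_sandwich_single:
  assumes ij: "i \<in> I" "j \<in> I" and z: "z \<in> C i j" and w: "w \<in> C i j" and y: "y \<in> A"
  shows "mulA (mulA (single i j z) y) (single i j w) = single i j (tern i j z (y j i) w)"
  using mult_single_sandwich[OF ij(1) ij(2) ij(1) ij(2) z w y] by (simp add: tern_eq)

lemma entry_mult_singles_right:
  assumes x: "x \<in> A" and ij: "i \<in> I" "j \<in> I" and g: "g \<in> C j i" and m: "m \<in> C i j"
  shows "mulA (mulA x (single j i g)) (single i j m) i j = tern i j (x i j) g m"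
  using mult_single_right[OF ij m mult_closed[OF x single_in_carrier[OF ij(2,1) g]]]
    mult_single_right[OF ij(2,1) g x] ij
  by (simp add: tern_eq)

lemma entry_mult_singles_left:
  assumes x: "x \<in> A" and ij: "i \<in> I" "j \<in> I" and g: "g \<in> C j i" and m: "m \<in> C i j"
  shows "mulA (mulA (single i j m) (single j i g)) x i j = tern i j m g (x i j)"
  using mult_single_left[OF ij(1) ij(1) mu_closed[OF ij(1) ij(2) ij(1) m g] x] ij
  by (simp add: single_mult_single tern_eq m g)

lemma supp_diff_single:
  fixes x :: "'i \<Rightarrow> 'i \<Rightarrow> 'a::ab_group_add"
  shows "(i, j) \<in> supp x \<Longrightarrow> supp (x - single i j (x i j)) = supp x - {(i, j)}"
  unfolding supp_def single_def by auto

lemma carrier_mem_if_singles: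
  assumes X0: "0 \<in> X" and Xadd: "\<And>a b. a \<in> X \<Longrightarrow> b \<in> X \<Longrightarrow> a + b \<in> X"
    and x: "x \<in> A" and singles: "\<And>i j. i \<in> I \<Longrightarrow> j \<in> I \<Longrightarrow> single i j (x i j) \<in> X"
  shows "x \<in> X"
proof -
  have "x \<in> X" if "finite F" "x \<in> A" "supp x = F" "\<forall>i\<in>I. \<forall>j\<in>I. single i j (x i j) \<in> X" for F x
    using that
  proof (induction F arbitrary: x rule: finite_induct)
    case empty
    then have "x = 0" unfolding supp_def by (auto simp: fun_eq_iff)
    then show ?case using X0 by blast
  next
    case (insert q F)
    obtain i j where q: "q = (i, j)" by force
    then have ij: "i \<in> I" "j \<in> I"
      using insert.prems(2) carrier_outside[OF insert.prems(1)] unfolding supp_def by blast+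
    let ?x' = "x - single i j (x i j)"
    have "single a b (?x' a b) \<in> X" if "a \<in> I" "b \<in> I" for a b
    proof (cases "a = i \<and> b = j")
      case False
      then have "?x' a b = x a b" by (auto simp: single_def)
      then show ?thesis using insert.prems(3) that by simp
    qed (use X0 in simp)
    moreover have "?x' \<in> A"
      using carrier_diff[OF insert.prems(1) single_in_carrier[OF ij carrier_entry[OF insert.prems(1) ij]]] .
    moreover have "supp ?x' = F"
      using supp_diff_single[of i j x] insert.prems(2) insert.hyps(2) q by auto
    ultimately have "?x' \<in> X" using insert.IH by blast
    then have "?x' + single i j (x i j) \<in> X" using Xadd insert.prems(3) ij by blast
    then show ?case by simp
  qed
  then show ?thesis using x singles finite_supp[OF x] by blast
qed

lemma ideal_mem_if_singles:
  "r_ideal A mulA X \<Longrightarrow> x \<in> A \<Longrightarrow> (\<And>i j. i \<in> I \<Longrightarrow> j \<in> I \<Longrightarrow> single i j (x i j) \<in> X) \<Longrightarrow> x \<in> X"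
  by (rule carrier_mem_if_singles) (auto intro: r_ideal_zero r_ideal_add)

definition entries :: "'i \<Rightarrow> 'i \<Rightarrow> ('i \<Rightarrow> 'i \<Rightarrow> 'a) set \<Rightarrow> 'a set" where
  "entries i j X = {x i j |x. x \<in> X}"

definition single_preimage :: "'i \<Rightarrow> 'i \<Rightarrow> ('i \<Rightarrow> 'i \<Rightarrow> 'a) set \<Rightarrow> 'a set" where
  "single_preimage i j X = {z \<in> C i j. single i j z \<in> X}"

lemma ideal_eq_gm_sum:
  assumes X: "r_ideal A mulA X"
    and entries: "\<And>i j. i \<in> I \<Longrightarrow> j \<in> I \<Longrightarrow> entries i j X \<subseteq> S i j"
    and singles: "\<And>i j. i \<in> I \<Longrightarrow> j \<in> I \<Longrightarrow> S i j \<subseteq> single_preimage i j X"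
  shows "X = gm_sum I C S"
proof
  show "X \<subseteq> gm_sum I C S"
    using entries r_ideal_subset[OF X] unfolding entries_def gm_sum_def by blast
  show "gm_sum I C S \<subseteq> X"
  proof
    fix x assume "x \<in> gm_sum I C S"
    then have x: "x \<in> A" and xS: "\<And>i j. i \<in> I \<Longrightarrow> j \<in> I \<Longrightarrow> x i j \<in> S i j"
      unfolding gm_sum_def by auto
    show "x \<in> X"
    proof (rule ideal_mem_if_singles[OF X x])
      fix i j assume "i \<in> I" "j \<in> I"
      then show "single i j (x i j) \<in> X"
        using xS singles unfolding single_preimage_def by blast
    qed
  qed
qed

lemma single_preimage_g_ideal:
  assumes X: "r_ideal A mulA X" and ij: "i \<in> I" "j \<in> I"
  shows "g_ideal (C i j) (C j i) (tern i j) (single_preimage i j X)"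
  unfolding g_ideal_def single_preimage_def
proof (intro conjI ballI)
  show "0 \<in> {z \<in> C i j. single i j z \<in> X}" using comp_zero ij r_ideal_zero[OF X] by simp
next
  fix x y assume "x \<in> {z \<in> C i j. single i j z \<in> X}" "y \<in> {z \<in> C i j. single i j z \<in> X}"
  then show "x - y \<in> {z \<in> C i j. single i j z \<in> X}"
    using comp_diff[OF ij] r_ideal_diff[OF X] single_diff by (metis (mono_tags, lifting) mem_Collect_eq)
next
  fix x g m assume x: "x \<in> {z \<in> C i j. single i j z \<in> X}" and g: "g \<in> C j i" and m: "m \<in> C i j"
  have Eg: "single j i g \<in> A" and Em: "single i j m \<in> A" using single_in_carrier ij g m by auto
  have "single i j (tern i j x g m) \<in> X"
    using single_tern[OF ij _ g m] x Eg Em r_ideal_mult_right[OF X] by auto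
  then show "tern i j x g m \<in> {z \<in> C i j. single i j z \<in> X}"
    using gamma_ring.tern_closed[OF comp_gamma_ring[OF ij]] x g m by auto
  have "single i j (tern i j m g x) \<in> X"
    using single_tern[OF ij m g] x Eg Em mult_closed r_ideal_mult_left[OF X] by auto
  then show "tern i j m g x \<in> {z \<in> C i j. single i j z \<in> X}"
    using gamma_ring.tern_closed[OF comp_gamma_ring[OF ij]] x g m by auto
qed auto

lemma entries_g_ideal:
  assumes X: "r_ideal A mulA X" and ij: "i \<in> I" "j \<in> I"
  shows "g_ideal (C i j) (C j i) (tern i j) (entries i j X)"
  unfolding g_ideal_def
proof (intro conjI ballI subsetI)
  fix z assume "z \<in> entries i j X"
  then show "z \<in> C i j"
    unfolding entries_def using carrier_entry r_ideal_subset[OF X] ij by blast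
next
  have "(0::'i \<Rightarrow> 'i \<Rightarrow> 'a) i j = 0" by simp
  then show "0 \<in> entries i j X"
    unfolding entries_def using r_ideal_zero[OF X] by (metis (mono_tags, lifting) mem_Collect_eq)
next
  fix a b assume "a \<in> entries i j X" "b \<in> entries i j X"
  then obtain x y where "a = x i j" "b = y i j" "x \<in> X" "y \<in> X" unfolding entries_def by blast
  then have "a - b = (x - y) i j" "x - y \<in> X" using r_ideal_diff[OF X] by auto
  then show "a - b \<in> entries i j X" unfolding entries_def by blast
next
  fix a g m assume a: "a \<in> entries i j X" and g: "g \<in> C j i" and m: "m \<in> C i j"
  then obtain x where e: "a = x i j" "x \<in> X" unfolding entries_def by blast
  have x: "x \<in> A" using e r_ideal_subset[OF X] by blast
  have Eg: "single j i g \<in> A" and Em: "single i j m \<in> A" using single_in_carrier ij g m by auto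
  have "mulA (mulA x (single j i g)) (single i j m) \<in> X"
    using r_ideal_mult_right[OF X] e Eg Em by auto
  moreover have "tern i j a g m = mulA (mulA x (single j i g)) (single i j m) i j"
    using entry_mult_singles_right[OF x ij g m] e by simp
  ultimately show "tern i j a g m \<in> entries i j X" unfolding entries_def by blast
  have "mulA (mulA (single i j m) (single j i g)) x \<in> X"
    using r_ideal_mult_left[OF X] e Eg Em mult_closed by auto
  moreover have "tern i j m g a = mulA (mulA (single i j m) (single j i g)) x i j"
    using entry_mult_singles_left[OF x ij g m] e by simp
  ultimately show "tern i j m g a \<in> entries i j X" unfolding entries_def by blast
qed

subsection \<open>The Baer radical\<close>

lemma g_prime_ideal_comp_sandwich:
  assumes ij: "i \<in> I" "j \<in> I" and Q: "g_prime_ideal (C i j) (C j i) (tern i j) Q"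
    and s: "s \<in> C i j" and usv: "\<And>u v. u \<in> C i i \<Longrightarrow> v \<in> C j j \<Longrightarrow> mu i j j (mu i i j u s) v \<in> Q"
  shows "s \<in> Q"
proof (rule gamma_ring.g_prime_ideal_sandwich[OF comp_gamma_ring[OF ij] Q s])
  fix m g g' m' assume mg: "m \<in> C i j" "g \<in> C j i" "g' \<in> C j i" "m' \<in> C i j"
  have "tern i j (tern i j m g s) g' m' = mu i j j (mu i i j (mu i j i m g) s) (mu j i j g' m')"
    unfolding tern_eq using mg ij s by (simp add: mu_assoc mu_closed)
  then show "tern i j (tern i j m g s) g' m' \<in> Q"
    using usv mg ij by (simp add: mu_closed)
qed

definition prime_lift :: "'i \<Rightarrow> 'i \<Rightarrow> 'a set \<Rightarrow> ('i \<Rightarrow> 'i \<Rightarrow> 'a) set" where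
  "prime_lift i j Q = {x \<in> A. \<forall>k\<in>I. \<forall>l\<in>I. \<forall>u\<in>C i k. \<forall>v\<in>C l j. mu i l j (mu i k l u (x k l)) v \<in> Q}"

lemma prime_lift_entry:
  assumes ij: "i \<in> I" "j \<in> I" and Q: "g_prime_ideal (C i j) (C j i) (tern i j) Q"
    and x: "x \<in> prime_lift i j Q"
  shows "x i j \<in> Q"
proof (rule g_prime_ideal_comp_sandwich[OF ij Q])
  have "x \<in> A" using x unfolding prime_lift_def by blast
  then show "x i j \<in> C i j" using carrier_entry ij by blast
  show "mu i j j (mu i i j u (x i j)) v \<in> Q" if "u \<in> C i i" "v \<in> C j j" for u v
    using x ij that unfolding prime_lift_def by blast
qed

lemma sandwich_mult_right:
  assumes x: "x \<in> A" and r: "r \<in> A" and ijkl: "i \<in> I" "j \<in> I" "k \<in> I" "l \<in> I"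
    and u: "u \<in> C i k" and v: "v \<in> C l j"
  shows "mu i l j (mu i k l u (mulA x r k l)) v
    = (\<Sum>m\<in>col_supp x. mu i m j (mu i k m u (x k m)) (mu m l j (r m l) v))"
proof -
  have "mu i l j (mu i k l u (mulA x r k l)) v
      = (\<Sum>m\<in>col_supp x. mu i l j (mu i k l u (mu k m l (x k m) (r m l))) v)"
    unfolding mult_entry_col_supp[OF x r ijkl(3,4)] using col_supp_subset[OF x] ijkl u v
    by (simp add: mu_sum_right mu_sum_left mu_closed carrier_entry x r subset_iff comp_sum)
  also have "\<dots> = (\<Sum>m\<in>col_supp x. mu i m j (mu i k m u (x k m)) (mu m l j (r m l) v))"
  proof (rule sum.cong[OF refl])
    fix m assume "m \<in> col_supp x"
    then have m: "m \<in> I" using col_supp_subset[OF x] by blast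
    note e = carrier_entry[OF x ijkl(3) m] carrier_entry[OF r m ijkl(4)]
    show "mu i l j (mu i k l u (mu k m l (x k m) (r m l))) v = mu i m j (mu i k m u (x k m)) (mu m l j (r m l) v)"
      using e ijkl m u v by (simp add: mu_assoc mu_closed)
  qed
  finally show ?thesis .
qed

lemma sandwich_mult_left:
  assumes x: "x \<in> A" and r: "r \<in> A" and ijkl: "i \<in> I" "j \<in> I" "k \<in> I" "l \<in> I"
    and u: "u \<in> C i k" and v: "v \<in> C l j"
  shows "mu i l j (mu i k l u (mulA r x k l)) v
    = (\<Sum>m\<in>col_supp r. mu i l j (mu i m l (mu i k m u (r k m)) (x m l)) v)"
proof -
  have "mu i l j (mu i k l u (mulA r x k l)) v
      = (\<Sum>m\<in>col_supp r. mu i l j (mu i k l u (mu k m l (r k m) (x m l))) v)"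
    unfolding mult_entry_col_supp[OF r x ijkl(3,4)] using col_supp_subset[OF r] ijkl u v
    by (simp add: mu_sum_right mu_sum_left mu_closed carrier_entry x r subset_iff comp_sum)
  also have "\<dots> = (\<Sum>m\<in>col_supp r. mu i l j (mu i m l (mu i k m u (r k m)) (x m l)) v)"
  proof (rule sum.cong[OF refl])
    fix m assume "m \<in> col_supp r"
    then have m: "m \<in> I" using col_supp_subset[OF r] by blast
    note e = carrier_entry[OF r ijkl(3) m] carrier_entry[OF x m ijkl(4)]
    show "mu i l j (mu i k l u (mu k m l (r k m) (x m l))) v = mu i l j (mu i m l (mu i k m u (r k m)) (x m l)) v"
      using e ijkl m u by (simp add: mu_assoc)
  qed
  finally show ?thesis .
qed

lemma prime_lift_mult_right:
  assumes ij: "i \<in> I" "j \<in> I" and Q: "g_ideal (C i j) (C j i) (tern i j) Q"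
    and x: "x \<in> prime_lift i j Q" and r: "r \<in> A"
  shows "mulA x r \<in> prime_lift i j Q"
proof -
  have xA: "x \<in> A" using x unfolding prime_lift_def by blast
  have "mu i l j (mu i k l u (mulA x r k l)) v \<in> Q"
    if kl: "k \<in> I" "l \<in> I" and uv: "u \<in> C i k" "v \<in> C l j" for k l u v
    unfolding sandwich_mult_right[OF xA r ij kl uv]
  proof (rule g_ideal_sum[OF Q])
    fix m assume "m \<in> col_supp x"
    then have m: "m \<in> I" using col_supp_subset[OF xA] by blast
    then have "mu m l j (r m l) v \<in> C m j" using kl uv ij carrier_entry[OF r m] by (intro mu_closed) auto
    then show "mu i m j (mu i k m u (x k m)) (mu m l j (r m l) v) \<in> Q"
      using x kl m uv unfolding prime_lift_def by blast
  qed
  then show ?thesis using xA r mult_closed unfolding prime_lift_def by blast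
qed

lemma prime_lift_mult_left:
  assumes ij: "i \<in> I" "j \<in> I" and Q: "g_ideal (C i j) (C j i) (tern i j) Q"
    and x: "x \<in> prime_lift i j Q" and r: "r \<in> A"
  shows "mulA r x \<in> prime_lift i j Q"
proof -
  have xA: "x \<in> A" using x unfolding prime_lift_def by blast
  have "mu i l j (mu i k l u (mulA r x k l)) v \<in> Q"
    if kl: "k \<in> I" "l \<in> I" and uv: "u \<in> C i k" "v \<in> C l j" for k l u v
    unfolding sandwich_mult_left[OF xA r ij kl uv]
  proof (rule g_ideal_sum[OF Q])
    fix m assume "m \<in> col_supp r"
    then have m: "m \<in> I" using col_supp_subset[OF r] by blast
    then have "mu i k m u (r k m) \<in> C i m" using kl uv ij carrier_entry[OF r] by (intro mu_closed) auto
    then show "mu i l j (mu i m l (mu i k m u (r k m)) (x m l)) v \<in> Q"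
      using x kl m uv unfolding prime_lift_def by blast
  qed
  then show ?thesis using xA r mult_closed unfolding prime_lift_def by blast
qed

lemma prime_lift_ideal:
  assumes ij: "i \<in> I" "j \<in> I" and Q: "g_ideal (C i j) (C j i) (tern i j) Q"
  shows "r_ideal A mulA (prime_lift i j Q)"
  unfolding r_ideal_def
proof (intro conjI ballI subsetI)
  show "0 \<in> prime_lift i j Q"
    unfolding prime_lift_def using carrier_zero g_ideal_zero[OF Q] ij by (auto simp: mu_zero_right mu_zero_left)
next
  fix x y assume x: "x \<in> prime_lift i j Q" and y: "y \<in> prime_lift i j Q"
  have "mu i l j (mu i k l u ((x - y) k l)) v \<in> Q"
    if kl: "k \<in> I" "l \<in> I" and uv: "u \<in> C i k" "v \<in> C l j" for k l u v
  proof -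
    have "x k l \<in> C k l" "y k l \<in> C k l" using x y carrier_entry kl unfolding prime_lift_def by auto
    then have "mu i l j (mu i k l u ((x - y) k l)) v
        = mu i l j (mu i k l u (x k l)) v - mu i l j (mu i k l u (y k l)) v"
      using kl uv ij by (simp add: mu_diff_right mu_diff_left mu_closed)
    then show ?thesis using x y kl uv g_ideal_diff[OF Q] unfolding prime_lift_def by auto
  qed
  then show "x - y \<in> prime_lift i j Q"
    using x y carrier_diff unfolding prime_lift_def by blast
next
  fix x r assume "x \<in> prime_lift i j Q" "r \<in> A"
  then show "mulA x r \<in> prime_lift i j Q" "mulA r x \<in> prime_lift i j Q"
    using prime_lift_mult_right[OF ij Q] prime_lift_mult_left[OF ij Q] by blast+
qed (simp add: prime_lift_def)

lemma ideal_not_subset_prime_lift: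
  assumes ij: "i \<in> I" "j \<in> I" and Z: "r_ideal A mulA Z" and z: "z \<in> Z" "z \<notin> prime_lift i j Q"
  shows "\<exists>s\<in>C i j. s \<notin> Q \<and> single i j s \<in> Z"
proof -
  have zA: "z \<in> A" using r_ideal_subset[OF Z] z by blast
  then obtain k l u v where kl: "k \<in> I" "l \<in> I" and uv: "u \<in> C i k" "v \<in> C l j"
    and notQ: "mu i l j (mu i k l u (z k l)) v \<notin> Q"
    using z unfolding prime_lift_def by blast
  have "single i j (mu i l j (mu i k l u (z k l)) v) = mulA (mulA (single i k u) z) (single l j v)"
    using mult_single_sandwich[OF ij(1) kl ij(2) uv zA] by simp
  also have "\<dots> \<in> Z"
    using kl ij uv z single_in_carrier
    by (intro r_ideal_mult_right[OF Z] r_ideal_mult_left[OF Z]) auto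
  finally show ?thesis
    using notQ kl ij uv carrier_entry[OF zA kl] by (blast intro: mu_closed)
qed

lemma prime_lift_prime:
  assumes ij: "i \<in> I" "j \<in> I" and Q: "g_prime_ideal (C i j) (C j i) (tern i j) Q"
  shows "r_prime_ideal A mulA (prime_lift i j Q)"
proof -
  have Qi: "g_ideal (C i j) (C j i) (tern i j) Q" and QM: "Q \<noteq> C i j"
    and prime: "\<And>X Y. g_ideal (C i j) (C j i) (tern i j) X \<Longrightarrow> g_ideal (C i j) (C j i) (tern i j) Y \<Longrightarrow>
        (\<forall>x\<in>X. \<forall>g\<in>C j i. \<forall>y\<in>Y. tern i j x g y \<in> Q) \<Longrightarrow> X \<subseteq> Q \<or> Y \<subseteq> Q"
    using Q unfolding g_prime_ideal_def by blast+
  obtain a where a: "a \<in> C i j" "a \<notin> Q" using QM g_ideal_subset[OF Qi] by blast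
  then have "single i j a \<notin> prime_lift i j Q"
    using prime_lift_entry[OF ij Q] by fastforce
  then have proper: "prime_lift i j Q \<noteq> A" using single_in_carrier[OF ij a(1)] by blast
  have "X \<subseteq> prime_lift i j Q \<or> Y \<subseteq> prime_lift i j Q"
    if X: "r_ideal A mulA X" and Y: "r_ideal A mulA Y"
      and XY: "\<forall>x\<in>X. \<forall>y\<in>Y. mulA x y \<in> prime_lift i j Q" for X Y
  proof (rule ccontr)
    assume "\<not> (X \<subseteq> prime_lift i j Q \<or> Y \<subseteq> prime_lift i j Q)"
    then obtain s s' where s: "s \<in> C i j" "s \<notin> Q" "single i j s \<in> X"
      and s': "s' \<in> C i j" "s' \<notin> Q" "single i j s' \<in> Y"
      using ideal_not_subset_prime_lift[OF ij X] ideal_not_subset_prime_lift[OF ij Y] by blast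
    have "single_preimage i j X \<subseteq> Q \<or> single_preimage i j Y \<subseteq> Q"
    proof (rule prime[OF single_preimage_g_ideal[OF X ij] single_preimage_g_ideal[OF Y ij]], intro ballI)
      fix z g w assume z: "z \<in> single_preimage i j X" and g: "g \<in> C j i" and w: "w \<in> single_preimage i j Y"
      then have "mulA (single i j z) (single j i g) \<in> X"
        using ij single_in_carrier r_ideal_mult_right[OF X] unfolding single_preimage_def by auto
      then have "single i j (tern i j z g w) \<in> prime_lift i j Q"
        using single_tern[OF ij _ g] XY z w unfolding single_preimage_def by auto
      then show "tern i j z g w \<in> Q" using prime_lift_entry[OF ij Q] by fastforce
    qed
    then show False using s s' unfolding single_preimage_def by blast
  qed
  then show ?thesis
    unfolding r_prime_ideal_def using prime_lift_ideal[OF ij Qi] proper by blast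
qed

lemma single_preimage_prime:
  assumes ij: "i \<in> I" "j \<in> I" and P: "r_prime_ideal A mulA P" and ne: "single_preimage i j P \<noteq> C i j"
  shows "g_prime_ideal (C i j) (C j i) (tern i j) (single_preimage i j P)"
  unfolding g_prime_ideal_def
proof (intro conjI allI impI)
  have Pi: "r_ideal A mulA P" using P unfolding r_prime_ideal_def by blast
  show "g_ideal (C i j) (C j i) (tern i j) (single_preimage i j P)"
    by (rule single_preimage_g_ideal[OF Pi ij])
  show "single_preimage i j P \<noteq> C i j" by (rule ne)
  fix X Y assume "g_ideal (C i j) (C j i) (tern i j) X \<and> g_ideal (C i j) (C j i) (tern i j) Y \<and>
      (\<forall>x\<in>X. \<forall>g\<in>C j i. \<forall>y\<in>Y. tern i j x g y \<in> single_preimage i j P)"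
  then have X: "X \<subseteq> C i j" and Y: "Y \<subseteq> C i j"
    and XY: "\<And>z g w. z \<in> X \<Longrightarrow> g \<in> C j i \<Longrightarrow> w \<in> Y \<Longrightarrow> tern i j z g w \<in> single_preimage i j P"
    using g_ideal_subset by blast+
  have "single i j z \<in> P \<or> single i j w \<in> P" if z: "z \<in> X" and w: "w \<in> Y" for z w
  proof (rule A.prime_ideal_elem[OF P])
    show "single i j z \<in> A" "single i j w \<in> A" using single_in_carrier ij X Y z w by blast+
    fix y assume y: "y \<in> A"
    have "mulA (mulA (single i j z) y) (single i j w) = single i j (tern i j z (y j i) w)"
      using mult_sandwich_single[OF ij _ _ y] X Y z w by blast
    then show "mulA (mulA (single i j z) y) (single i j w) \<in> P"
      using XY[OF z carrier_entry[OF y ij(2,1)] w] unfolding single_preimage_def by simp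
  qed
  then show "X \<subseteq> single_preimage i j P \<or> Y \<subseteq> single_preimage i j P"
    using X Y unfolding single_preimage_def by blast
qed

lemma baer_eq_gm_sum: "r_baer A mulA = gm_sum I C (comp_rad Baer C mu)"
proof (rule ideal_eq_gm_sum[OF A.baer_ideal])
  fix i j assume ij: "i \<in> I" "j \<in> I"
  show "entries i j (r_baer A mulA) \<subseteq> comp_rad Baer C mu i j"
  proof
    fix z assume "z \<in> entries i j (r_baer A mulA)"
    then obtain x where x: "x \<in> A" "\<And>P. r_prime_ideal A mulA P \<Longrightarrow> x \<in> P" and z: "z = x i j"
      unfolding entries_def r_baer_def by blast
    have "z \<in> Q" if "g_prime_ideal (C i j) (C j i) (tern i j) Q" for Q
      using prime_lift_entry[OF ij that x(2)[OF prime_lift_prime[OF ij that]]] z by simp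
    then show "z \<in> comp_rad Baer C mu i j"
      unfolding comp_rad_def gamma_rad.simps g_baer_def using carrier_entry[OF x(1) ij] z by simp
  qed
  show "comp_rad Baer C mu i j \<subseteq> single_preimage i j (r_baer A mulA)"
  proof
    fix z assume "z \<in> comp_rad Baer C mu i j"
    then have z: "z \<in> C i j" "\<And>Q. g_prime_ideal (C i j) (C j i) (tern i j) Q \<Longrightarrow> z \<in> Q"
      unfolding comp_rad_def gamma_rad.simps g_baer_def by auto
    have "single i j z \<in> P" if "r_prime_ideal A mulA P" for P
      using z single_preimage_prime[OF ij that] unfolding single_preimage_def by blast
    then show "z \<in> single_preimage i j (r_baer A mulA)"
      unfolding single_preimage_def r_baer_def using z(1) single_in_carrier[OF ij] by blast
  qed
qed

definition row_set :: "'i \<Rightarrow> 'a set \<Rightarrow> ('i \<Rightarrow> 'i \<Rightarrow> 'a) set" where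
  "row_set i D = {x \<in> A. (\<forall>k l. k \<noteq> i \<longrightarrow> x k l = 0) \<and> x i i \<in> D
     \<and> (\<forall>l\<in>I. \<forall>c\<in>C l i. mu i l i (x i l) c \<in> D)}"

lemma mult_row_zero:
  assumes x: "x \<in> A" and r: "r \<in> A" and row: "\<And>l. x k l = 0"
  shows "mulA x r k l = 0"
proof (cases "k \<in> I \<and> l \<in> I")
  case True
  then have "mulA x r k l = (\<Sum>m\<in>col_supp x. mu k m l (x k m) (r m l))"
    using mult_entry_col_supp[OF x r] by blast
  also have "\<dots> = 0"
    using True row col_supp_subset[OF x] carrier_entry[OF r] mu_zero_left by (intro sum.neutral) auto
  finally show ?thesis .
qed (simp add: mult_outside)

lemma mult_entry_row:
  assumes x: "x \<in> A" and z: "z \<in> A" and row: "\<And>k l. k \<noteq> i \<Longrightarrow> z k l = 0"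
    and il: "i \<in> I" "l \<in> I"
  shows "mulA x z i l = mu i i l (x i i) (z i l)"
  by (rule mult_entry_single_index[OF x z il(1) il(1) il(2)]) (use row in auto)

lemma row_set_mult_right:
  assumes i: "i \<in> I" and D0: "0 \<in> D" and Ddiff: "\<And>a b. a \<in> D \<Longrightarrow> b \<in> D \<Longrightarrow> a - b \<in> D"
    and x: "x \<in> row_set i D" and r: "r \<in> A"
  shows "mulA x r \<in> row_set i D"
proof -
  have xA: "x \<in> A" and xrow: "\<And>k l. k \<noteq> i \<Longrightarrow> x k l = 0"
    and xD: "\<And>l c. l \<in> I \<Longrightarrow> c \<in> C l i \<Longrightarrow> mu i l i (x i l) c \<in> D"
    using x unfolding row_set_def by auto
  have K: "\<And>m. m \<in> col_supp x \<Longrightarrow> m \<in> I" using col_supp_subset[OF xA] by blast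
  have "mulA x r i i \<in> D"
    unfolding mult_entry_col_supp[OF xA r i i] using xD K carrier_entry[OF r] i
    by (auto intro: subgroup_sum_mem[of D, OF D0 Ddiff])
  moreover have "mu i l i (mulA x r i l) c \<in> D" if l: "l \<in> I" and c: "c \<in> C l i" for l c
  proof -
    have "mu i l i (mulA x r i l) c = (\<Sum>m\<in>col_supp x. mu i l i (mu i m l (x i m) (r m l)) c)"
      unfolding mult_entry_col_supp[OF xA r i l] using K i l c carrier_entry[OF xA] carrier_entry[OF r]
      by (intro mu_sum_left) (auto intro!: mu_closed)
    also have "\<dots> = (\<Sum>m\<in>col_supp x. mu i m i (x i m) (mu m l i (r m l) c))"
      using K i l c carrier_entry[OF xA] carrier_entry[OF r] by (intro sum.cong refl mu_assoc) auto
    also have "\<dots> \<in> D"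
    proof (rule subgroup_sum_mem[of D, OF D0 Ddiff])
      fix m assume "m \<in> col_supp x"
      then have m: "m \<in> I" using K by blast
      show "mu i m i (x i m) (mu m l i (r m l) c) \<in> D"
        using xD[OF m mu_closed[OF m l i carrier_entry[OF r m l] c]] .
    qed
    finally show ?thesis .
  qed
  ultimately show ?thesis
    unfolding row_set_def using mult_closed[OF xA r] mult_row_zero[OF xA r] xrow by auto
qed

lemma row_set_right_ideal:
  assumes i: "i \<in> I" and D0: "0 \<in> D" and Ddiff: "\<And>a b. a \<in> D \<Longrightarrow> b \<in> D \<Longrightarrow> a - b \<in> D"
  shows "r_right_ideal A mulA (row_set i D)"
  unfolding r_right_ideal_def
proof (intro conjI ballI subsetI)
  show "0 \<in> row_set i D"
    unfolding row_set_def using carrier_zero D0 i mu_zero_left by auto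
next
  fix x y assume x: "x \<in> row_set i D" and y: "y \<in> row_set i D"
  then have xA: "x \<in> A" and yA: "y \<in> A" unfolding row_set_def by auto
  have "mu i l i ((x - y) i l) c \<in> D" if l: "l \<in> I" and c: "c \<in> C l i" for l c
  proof -
    have "mu i l i ((x - y) i l) c = mu i l i (x i l) c - mu i l i (y i l) c"
      using mu_diff_left[OF i l i carrier_entry[OF xA i l] carrier_entry[OF yA i l] c] by simp
    then show ?thesis using x y l c Ddiff unfolding row_set_def by auto
  qed
  then show "x - y \<in> row_set i D"
    using x y carrier_diff Ddiff unfolding row_set_def by auto
next
  fix x r assume "x \<in> row_set i D" "r \<in> A"
  then show "mulA x r \<in> row_set i D" using row_set_mult_right[OF i D0 Ddiff] by blast
qed (simp add: row_set_def)

subsection \<open>The Jacobson radical\<close>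

lemma g_rqr_of_comp_rqr:
  assumes ij: "i \<in> I" "j \<in> I" and a: "a \<in> C i j" and g: "g \<in> C j i"
    and w: "w \<in> C i i" "mu i j i a g + w - mu i i i (mu i j i a g) w = 0"
  shows "\<exists>y\<in>C i j. a + y - tern i j a g y = 0"
proof
  let ?c = "mu i j i a g"
  have c: "?c \<in> C i i" using a g ij by (intro mu_closed) auto
  have wa: "mu i i j w a \<in> C i j" using w a ij by (intro mu_closed) auto
  show "- a + mu i i j w a \<in> C i j" using comp_add[OF ij comp_neg[OF ij a] wa] .
  have "0 = mu i i j (?c + w - mu i i i ?c w) a"
    unfolding w(2) using mu_zero_left[OF ij(1) ij(1) ij(2) a] by simp
  also have "\<dots> = mu i i j ?c a + mu i i j w a - mu i i j (mu i i i ?c w) a"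
    using c w(1) a ij by (simp add: mu_diff_left mu_add_left comp_add mu_closed)
  also have "mu i i j (mu i i i ?c w) a = mu i i j ?c (mu i i j w a)"
    using mu_assoc[OF ij(1) ij(1) ij(1) ij(2) c w(1) a] .
  also have "mu i i j ?c a + mu i i j w a - mu i i j ?c (mu i i j w a)
      = a + (- a + mu i i j w a) - tern i j a g (- a + mu i i j w a)"
    unfolding tern_eq using c a wa ij by (simp add: mu_diff_right comp_diff)
  finally show "a + (- a + mu i i j w a) - tern i j a g (- a + mu i i j w a) = 0" by simp
qed

lemma comp_rqr_of_rqr_mult_single:
  assumes x: "x \<in> A" and ij: "i \<in> I" "j \<in> I" and g: "g \<in> C j i"
    and q: "r_rqr A mulA (mulA x (single j i g))"
  shows "\<exists>w\<in>C i i. mu i j i (x i j) g + w - mu i i i (mu i j i (x i j) g) w = 0"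
proof -
  let ?u = "mulA x (single j i g)"
  have u: "?u \<in> A" using mult_closed x single_in_carrier ij g by auto
  obtain z where z: "z \<in> A" "?u + z - mulA ?u z = 0" using q unfolding r_rqr_def by blast
  have ue: "?u i k = (if k = i then mu i j i (x i j) g else 0)" if "k \<in> I" for k
    using mult_single_right[OF ij(2) ij(1) g x] ij that by auto
  have "mulA ?u z i i = mu i i i (?u i i) (z i i)"
    by (rule mult_entry_single_index[OF u z(1) ij(1) ij(1) ij(1)]) (use ue in auto)
  moreover have "?u i i + z i i - mulA ?u z i i = 0"
    using fun_cong[OF fun_cong[OF z(2), of i], of i] by simp
  ultimately show ?thesis using ue ij carrier_entry[OF z(1) ij(1) ij(1)] by auto
qed

lemma entries_g_rqr:
  assumes X: "r_ideal A mulA X" and Xq: "\<And>x. x \<in> X \<Longrightarrow> r_rqr A mulA x" and ij: "i \<in> I" "j \<in> I"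
    and a: "a \<in> entries i j X"
  shows "g_rqr (C i j) (C j i) (tern i j) a"
  unfolding g_rqr_def
proof
  fix g assume g: "g \<in> C j i"
  obtain x where e: "a = x i j" "x \<in> X" using a unfolding entries_def by blast
  have x: "x \<in> A" using e r_ideal_subset[OF X] by blast
  have "mulA x (single j i g) \<in> X" using r_ideal_mult_right[OF X e(2)] single_in_carrier ij g by auto
  then obtain w where "w \<in> C i i" "mu i j i a g + w - mu i i i (mu i j i a g) w = 0"
    using comp_rqr_of_rqr_mult_single[OF x ij g] Xq e(1) by blast
  then show "\<exists>y\<in>C i j. a + y - tern i j a g y = 0"
    using g_rqr_of_comp_rqr[OF ij _ g] carrier_entry[OF x ij] e(1) by blast
qed

lemma rqr_right_ideal_comp_mult:
  assumes ij: "i \<in> I" "j \<in> I" and n: "n \<in> C i j" and q: "g_rqr (C i j) (C j i) (tern i j) n"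
  shows "rqr_right_ideal (C i i) (mu i i i) {mu i j i n g |g. g \<in> C j i}"
  unfolding rqr_right_ideal_def r_right_ideal_def
proof (intro conjI ballI subsetI)
  fix x assume "x \<in> {mu i j i n g |g. g \<in> C j i}"
  then show "x \<in> C i i" using ij n mu_closed by blast
next
  have "0 = mu i j i n 0" using mu_zero_right ij n by simp
  then show "0 \<in> {mu i j i n g |g. g \<in> C j i}" using comp_zero ij by blast
next
  fix x y assume "x \<in> {mu i j i n g |g. g \<in> C j i}" "y \<in> {mu i j i n g |g. g \<in> C j i}"
  then obtain g h where e: "x = mu i j i n g" "y = mu i j i n h" "g \<in> C j i" "h \<in> C j i" by blast
  then have "x - y = mu i j i n (g - h)" "g - h \<in> C j i" using mu_diff_right comp_diff ij n by auto
  then show "x - y \<in> {mu i j i n g |g. g \<in> C j i}" by blast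
next
  fix x r assume "x \<in> {mu i j i n g |g. g \<in> C j i}" and r: "r \<in> C i i"
  then obtain g where e: "x = mu i j i n g" "g \<in> C j i" by blast
  then have "mu i i i x r = mu i j i n (mu j i i g r)" "mu j i i g r \<in> C j i"
    using mu_assoc mu_closed ij n r by auto
  then show "mu i i i x r \<in> {mu i j i n g |g. g \<in> C j i}" by blast
next
  fix x assume "x \<in> {mu i j i n g |g. g \<in> C j i}"
  then obtain g where e: "x = mu i j i n g" "g \<in> C j i" by blast
  obtain y where y: "y \<in> C i j" "n + y - tern i j n g y = 0" using q e unfolding g_rqr_def by blast
  have yg: "mu i j i y g \<in> C i i" using ij y e by (auto intro: mu_closed)
  have "0 = mu i j i (n + y - tern i j n g y) g" using y(2) mu_zero_left ij e by simp
  also have "\<dots> = mu i j i n g + mu i j i y g - mu i j i (tern i j n g y) g"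
    using ij n y(1) e gamma_ring.tern_closed[OF comp_gamma_ring[OF ij]]
    by (simp add: mu_diff_left mu_add_left comp_add)
  also have "mu i j i (tern i j n g y) g = mu i i i x (mu i j i y g)"
    unfolding tern_eq e(1) using ij n y(1) e by (intro mu_assoc) (auto intro: mu_closed)
  finally show "r_rqr (C i i) (mu i i i) x" unfolding r_rqr_def using yg e(1) by auto
qed

lemma row_rqr:
  assumes x: "x \<in> A" and i: "i \<in> I" and row: "\<And>k l. k \<noteq> i \<Longrightarrow> x k l = 0"
    and w: "w \<in> C i i" "x i i + w - mu i i i (x i i) w = 0"
  shows "r_rqr A mulA x"
proof -
  define y where "y = (\<lambda>k l. if k = i \<and> l \<in> I then - x i l + mu i i l w (x i l) else 0)"
  have y: "y \<in> A"
  proof (rule carrierI)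
    show "y k l \<in> C k l" if "k \<in> I" "l \<in> I" for k l
      using that i w(1) carrier_entry[OF x] comp_zero
      by (auto simp: y_def intro!: comp_diff mu_closed)
    have "supp y \<subseteq> supp x"
      unfolding supp_def y_def using mu_zero_right i w(1) by auto
    then show "finite (supp y)" using finite_supp[OF x] finite_subset by blast
  qed (use i in \<open>auto simp: y_def\<close>)
  have inside: "(x + y - mulA x y) i l = 0" if l: "l \<in> I" for l
  proof -
    note e = carrier_entry[OF x i i] carrier_entry[OF x i l]
    have xw: "mu i i i (x i i) w \<in> C i i" using mu_closed[OF i i i e(1) w(1)] .
    have "mulA x y i l = mu i i l (x i i) (- x i l + mu i i l w (x i l))"
      using mult_entry_row[OF x y _ i l] l by (simp add: y_def)
    also have "\<dots> = - mu i i l (x i i) (x i l) + mu i i l (mu i i i (x i i) w) (x i l)"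
      using e w(1) i l by (simp add: mu_diff_right mu_assoc mu_closed)
    finally have "(x + y - mulA x y) i l = mu i i l (x i i + w - mu i i i (x i i) w) (x i l)"
      using e w(1) xw i l by (simp add: y_def mu_diff_left mu_add_left comp_add)
    then show ?thesis using w(2) mu_zero_left i l e by simp
  qed
  have outside: "(x + y - mulA x y) k l = 0" if "\<not> (k = i \<and> l \<in> I)" for k l
    using that row carrier_outside[OF x] mult_row_zero[OF x y] mult_outside i
    by (cases "k = i") (auto simp: y_def)
  have "x + y - mulA x y = 0"
  proof (intro ext)
    fix k l
    show "(x + y - mulA x y) k l = 0 k l"
      using inside[of l] outside[of k l] by (cases "k = i \<and> l \<in> I") auto
  qed
  then show ?thesis unfolding r_rqr_def using y by blast
qed

lemma row_set_jacobson_rqr: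
  assumes i: "i \<in> I"
  shows "rqr_right_ideal A mulA (row_set i (r_jacobson (C i i) (mu i i i)))"
proof -
  interpret Ci: rng "C i i" "mu i i i" by (rule comp_rng[OF i])
  have "r_rqr A mulA x" if "x \<in> row_set i (r_jacobson (C i i) (mu i i i))" for x
  proof -
    have x: "x \<in> A" "\<And>k l. k \<noteq> i \<Longrightarrow> x k l = 0" "x i i \<in> r_jacobson (C i i) (mu i i i)"
      using that unfolding row_set_def by auto
    then obtain w where "w \<in> C i i" "x i i + w - mu i i i (x i i) w = 0"
      using Ci.jacobson_rqr unfolding r_rqr_def by blast
    then show ?thesis using row_rqr[OF x(1) i x(2)] by blast
  qed
  moreover have "r_right_ideal A mulA (row_set i (r_jacobson (C i i) (mu i i i)))"
    using row_set_right_ideal[OF i] r_ideal_zero r_ideal_diff Ci.jacobson_ideal by metis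
  ultimately show ?thesis unfolding rqr_right_ideal_def by blast
qed

lemma single_in_jacobson:
  assumes ij: "i \<in> I" "j \<in> I" and n: "n \<in> C i j" and q: "g_rqr (C i j) (C j i) (tern i j) n"
  shows "single i j n \<in> r_jacobson A mulA"
proof (rule A.jacobson_if_mult_right_jacobson[OF single_in_carrier[OF ij n]])
  interpret Ci: rng "C i i" "mu i i i" by (rule comp_rng[OF ij(1)])
  let ?D = "r_jacobson (C i i) (mu i i i)"
  have nD: "mu i j i n g \<in> ?D" if "g \<in> C j i" for g
    using Ci.rqr_right_ideal_subset_jacobson[OF rqr_right_ideal_comp_mult[OF ij n q]] that by blast
  fix y assume y: "y \<in> A"
  have e: "mulA (single i j n) y k l = (if k = i \<and> l \<in> I then mu i j l n (y j l) else 0)" for k l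
    using mult_single_left[OF ij n y] .
  have "mu i l i (mu i j l n (y j l)) c \<in> ?D" if l: "l \<in> I" and c: "c \<in> C l i" for l c
    using nD mu_closed[OF ij(2) l ij(1) carrier_entry[OF y ij(2) l] c]
      mu_assoc[OF ij(1) ij(2) l ij(1) n carrier_entry[OF y ij(2) l] c] by simp
  then have "mulA (single i j n) y \<in> row_set i ?D"
    unfolding row_set_def using e mult_closed[OF single_in_carrier[OF ij n] y] ij
      nD[OF carrier_entry[OF y ij(2) ij(1)]] by auto
  then show "mulA (single i j n) y \<in> r_jacobson A mulA"
    using A.rqr_right_ideal_subset_jacobson[OF row_set_jacobson_rqr[OF ij(1)]] by blast
qed

lemma jacobson_eq_gm_sum: "r_jacobson A mulA = gm_sum I C (comp_rad Jacobson C mu)"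
proof (rule ideal_eq_gm_sum[OF A.jacobson_ideal])
  fix i j assume ij: "i \<in> I" "j \<in> I"
  show "entries i j (r_jacobson A mulA) \<subseteq> comp_rad Jacobson C mu i j"
    unfolding comp_rad_def gamma_rad.simps
    using rqr_g_ideal_subset_g_jacobson[OF entries_g_ideal[OF A.jacobson_ideal ij]]
      entries_g_rqr[OF A.jacobson_ideal A.jacobson_rqr ij] by blast
  show "comp_rad Jacobson C mu i j \<subseteq> single_preimage i j (r_jacobson A mulA)"
    unfolding comp_rad_def gamma_rad.simps
  proof (rule g_jacobson_least[OF single_preimage_g_ideal[OF A.jacobson_ideal ij]])
    fix N assume N: "g_ideal (C i j) (C j i) (tern i j) N" "\<forall>x\<in>N. g_rqr (C i j) (C j i) (tern i j) x"
    then show "N \<subseteq> single_preimage i j (r_jacobson A mulA)"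
      unfolding single_preimage_def using g_ideal_subset[OF N(1)] single_in_jacobson[OF ij] by blast
  qed
qed

subsection \<open>The Levitzki radical\<close>

lemma gprod_eq_entry_list_prod:
  assumes ij: "i \<in> I" "j \<in> I" and \<Phi>: "\<Phi> \<subseteq> C j i"
    and lift: "\<And>f. f \<in> S \<Longrightarrow> lift f \<in> A" "\<And>f. f \<in> S \<Longrightarrow> lift f i j = f"
    and x: "x \<in> S" and ys: "set ys \<subseteq> \<Phi> \<times> S"
  shows "\<exists>zs. length zs = Suc (length ys)
    \<and> set zs \<subseteq> lift ` S \<union> (\<lambda>(f, g). mulA (lift f) (single j i g)) ` (S \<times> \<Phi>)
    \<and> list_prod mulA zs i j = gprod (tern i j) x ys"
  using x ys
proof (induction ys arbitrary: x)
  case Nil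
  then show ?case using lift(2) by (intro exI[of _ "[lift x]"]) simp
next
  case (Cons q ys)
  obtain g y where q: "q = (g, y)" by force
  with Cons.prems have g: "g \<in> \<Phi>" and y: "y \<in> S" and ys: "set ys \<subseteq> \<Phi> \<times> S" by auto
  obtain zs where zs: "length zs = Suc (length ys)"
    "set zs \<subseteq> lift ` S \<union> (\<lambda>(f, g). mulA (lift f) (single j i g)) ` (S \<times> \<Phi>)"
    "list_prod mulA zs i j = gprod (tern i j) y ys"
    using Cons.IH[OF y ys] by blast
  have gC: "g \<in> C j i" using g \<Phi> by blast
  have lx: "lift x \<in> A" "lift x i j = x" using lift Cons.prems(1) by auto
  let ?u = "mulA (lift x) (single j i g)"
  have u: "?u \<in> A" using mult_closed[OF lx(1) single_in_carrier[OF ij(2,1) gC]] .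
  have "lift ` S \<union> (\<lambda>(f, g). mulA (lift f) (single j i g)) ` (S \<times> \<Phi>) \<subseteq> A"
    using lift(1) \<Phi> ij by (auto intro!: mult_closed single_in_carrier)
  then have "set zs \<subseteq> A" using zs(2) by (rule order_trans[rotated])
  then have W: "list_prod mulA zs \<in> A" by (rule A.list_prod_closed)
  have ue: "?u a b = (if a \<in> I \<and> b = i then mu a j i (lift x a j) g else 0)" for a b
    by (rule mult_single_right[OF ij(2) ij(1) gC lx(1)])
  have "mulA ?u (list_prod mulA zs) i j = mu i i j (?u i i) (list_prod mulA zs i j)"
    by (rule mult_entry_single_index[OF u W ij(1) ij(1) ij(2)]) (simp add: ue)
  also have "\<dots> = gprod (tern i j) x (q # ys)"
    using ue ij lx(2) zs(3) q by (simp add: tern_eq)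
  finally have "list_prod mulA (?u # zs) i j = gprod (tern i j) x (q # ys)"
    using zs(1) by (cases zs) simp_all
  moreover have "set (?u # zs) \<subseteq> lift ` S \<union> (\<lambda>(f, g). mulA (lift f) (single j i g)) ` (S \<times> \<Phi>)"
    using zs(2) Cons.prems(1) g by auto
  ultimately show ?case using zs(1) by (intro exI[of _ "?u # zs"]) simp
qed

lemma entries_loc_nilpotent:
  assumes X: "r_ideal A mulA X" and Xn: "r_loc_nilpotent mulA X" and ij: "i \<in> I" "j \<in> I"
  shows "g_loc_nilpotent (C j i) (tern i j) (entries i j X)"
  unfolding g_loc_nilpotent_def
proof (intro allI impI)
  fix F \<Phi> assume h: "finite F \<and> F \<subseteq> entries i j X \<and> finite \<Phi> \<and> \<Phi> \<subseteq> C j i"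
  then have "\<forall>f\<in>F. \<exists>x. x \<in> X \<and> x i j = f" unfolding entries_def by blast
  then obtain lift where lift: "\<And>f. f \<in> F \<Longrightarrow> lift f \<in> X \<and> lift f i j = f" by metis
  define F' where "F' = lift ` F \<union> (\<lambda>(f, g). mulA (lift f) (single j i g)) ` (F \<times> \<Phi>)"
  have "finite F'" unfolding F'_def using h by simp
  moreover have "F' \<subseteq> X"
    unfolding F'_def using lift h r_ideal_mult_right[OF X] single_in_carrier ij by auto
  ultimately obtain n where "\<forall>x xs. x \<in> F' \<and> set xs \<subseteq> F' \<and> length xs = n \<longrightarrow> lprod mulA x xs = 0"
    using Xn[unfolded r_loc_nilpotent_def, rule_format, of F'] by blast
  then have n: "\<And>zs. set zs \<subseteq> F' \<Longrightarrow> length zs = Suc n \<Longrightarrow> list_prod mulA zs = 0"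
    by (auto simp: length_Suc_conv)
  have "gprod (tern i j) x ys = 0" if x: "x \<in> F" and ys: "set ys \<subseteq> \<Phi> \<times> F" "length ys = n" for x ys
  proof -
    have liftA: "\<And>f. f \<in> F \<Longrightarrow> lift f \<in> A" and liftij: "\<And>f. f \<in> F \<Longrightarrow> lift f i j = f"
      using lift r_ideal_subset[OF X] by blast+
    obtain zs where "length zs = Suc n" "set zs \<subseteq> F'" "list_prod mulA zs i j = gprod (tern i j) x ys"
      using gprod_eq_entry_list_prod[OF ij _ liftA liftij x ys(1)] h ys(2) unfolding F'_def
      by blast
    then show ?thesis using n by simp
  qed
  then show "\<exists>n. \<forall>x ys. x \<in> F \<and> set ys \<subseteq> \<Phi> \<times> F \<and> length ys = n \<longrightarrow> gprod (tern i j) x ys = 0"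
    by blast
qed

text \<open>Elements \<open>n u\<close> of \<open>A\<^sub>i\<^sub>i\<close> with \<open>n \<in> A\<^sub>i\<^sub>j\<close>, where the optional factor \<open>u \<in> A\<^sub>j\<^sub>i\<close>
  may be omitted only if \<open>i = j\<close>.\<close>
definition opt_ok :: "'i \<Rightarrow> 'i \<Rightarrow> 'a option \<Rightarrow> bool" where
  "opt_ok i j u = (case u of None \<Rightarrow> i = j | Some g \<Rightarrow> g \<in> C j i)"

definition opt_mu :: "'i \<Rightarrow> 'i \<Rightarrow> 'a \<Rightarrow> 'a option \<Rightarrow> 'a" where
  "opt_mu i j n u = (case u of None \<Rightarrow> n | Some g \<Rightarrow> mu i j i n g)"

definition opt_gamma :: "'i \<Rightarrow> 'i \<Rightarrow> 'a option \<Rightarrow> 'a \<Rightarrow> 'a option \<Rightarrow> 'a" where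
  "opt_gamma i j u n u' = (let c = (case u of None \<Rightarrow> n | Some g \<Rightarrow> mu j i j g n) in
     (case u' of None \<Rightarrow> c | Some g' \<Rightarrow> mu j j i c g'))"

lemma opt_mu_closed: "i \<in> I \<Longrightarrow> j \<in> I \<Longrightarrow> n \<in> C i j \<Longrightarrow> opt_ok i j u \<Longrightarrow> opt_mu i j n u \<in> C i i"
  unfolding opt_ok_def opt_mu_def by (cases u) (auto intro: mu_closed)

lemma opt_gamma_closed:
  "i \<in> I \<Longrightarrow> j \<in> I \<Longrightarrow> n \<in> C i j \<Longrightarrow> opt_ok i j u \<Longrightarrow> opt_ok i j u' \<Longrightarrow> opt_gamma i j u n u' \<in> C j i"
  unfolding opt_ok_def opt_gamma_def by (cases u; cases u') (auto intro!: mu_closed)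

lemma opt_mu_zero: "i \<in> I \<Longrightarrow> j \<in> I \<Longrightarrow> opt_ok i j u \<Longrightarrow> opt_mu i j 0 u = 0"
  unfolding opt_ok_def opt_mu_def by (cases u) (auto simp: mu_zero_left)

lemma opt_mu_mult_opt_mu:
  assumes ij: "i \<in> I" "j \<in> I" and n: "n \<in> C i j" "n' \<in> C i j" "w \<in> C i j"
    and u: "opt_ok i j u" "opt_ok i j u'" "opt_ok i j u''"
  shows "mu i i i (opt_mu i j n u) (mu i i i (opt_mu i j n' u') (opt_mu i j w u''))
    = opt_mu i j (tern i j n (opt_gamma i j u n' u') w) u''"
  using ij n u unfolding opt_ok_def opt_mu_def opt_gamma_def
  by (cases u; cases u'; cases u'') (auto simp: tern_eq mu_assoc mu_closed)

definition opt_mu_set :: "'i \<Rightarrow> 'i \<Rightarrow> 'a set \<Rightarrow> 'a set" where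
  "opt_mu_set i j N = {opt_mu i j n u |n u. n \<in> N \<and> opt_ok i j u}"

lemma opt_mu_set_subset: "i \<in> I \<Longrightarrow> j \<in> I \<Longrightarrow> N \<subseteq> C i j \<Longrightarrow> opt_mu_set i j N \<subseteq> C i i"
  unfolding opt_mu_set_def using opt_mu_closed by blast

text \<open>A product of \<open>2k + 1\<close> factors \<open>n\<^sub>m u\<^sub>m\<close> is read as a \<open>\<Gamma>\<close>-product of length \<open>k\<close>,
  the middle factors \<open>u\<^sub>2\<^sub>m n\<^sub>2\<^sub>m\<^sub>+\<^sub>1 u\<^sub>2\<^sub>m\<^sub>+\<^sub>1\<close> serving as elements of \<open>\<Gamma>\<close>.\<close>
lemma lprod_opt_mu_eq_gprod:
  assumes ij: "i \<in> I" "j \<in> I" and Q: "\<And>q. q \<in> Q \<Longrightarrow> fst q \<in> C i j \<and> opt_ok i j (snd q)"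
    and q: "q \<in> Q" and qs: "set qs \<subseteq> Q" "length qs = 2 * k"
  shows "\<exists>ys u. set ys \<subseteq> (\<lambda>(q, q'). opt_gamma i j (snd q) (fst q') (snd q')) ` (Q \<times> Q) \<times> fst ` Q
    \<and> length ys = k \<and> opt_ok i j u
    \<and> lprod (mu i i i) (opt_mu i j (fst q) (snd q)) (map (\<lambda>q. opt_mu i j (fst q) (snd q)) qs)
      = opt_mu i j (gprod (tern i j) (fst q) ys) u"
  using q qs
proof (induction k arbitrary: q qs)
  case 0
  then show ?case using Q by (intro exI[of _ "[]"] exI[of _ "snd q"]) auto
next
  case (Suc k)
  let ?\<Gamma> = "(\<lambda>(q, q'). opt_gamma i j (snd q) (fst q') (snd q')) ` (Q \<times> Q)"
  obtain q1 q2 qs' where qs: "qs = q1 # q2 # qs'" "q1 \<in> Q" "q2 \<in> Q" "set qs' \<subseteq> Q" "length qs' = 2 * k"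
    using Suc.prems(2,3) by (cases qs rule: remdups_adj.cases) auto
  obtain ys u where ys: "set ys \<subseteq> ?\<Gamma> \<times> fst ` Q" "length ys = k" "opt_ok i j u"
    "lprod (mu i i i) (opt_mu i j (fst q2) (snd q2)) (map (\<lambda>q. opt_mu i j (fst q) (snd q)) qs')
      = opt_mu i j (gprod (tern i j) (fst q2) ys) u"
    using Suc.IH[OF qs(3,4,5)] by blast
  let ?g = "opt_gamma i j (snd q) (fst q1) (snd q1)"
  have "?g \<in> ?\<Gamma>" using Suc.prems(1) qs(2) by (auto intro!: image_eqI[of _ _ "(q, q1)"])
  then have set_ys: "set ((?g, fst q2) # ys) \<subseteq> ?\<Gamma> \<times> fst ` Q" using ys(1) qs(3) by auto
  have "?\<Gamma> \<subseteq> C j i" using Q opt_gamma_closed[OF ij] by auto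
  then have "set ys \<subseteq> C j i \<times> C i j" using ys(1) Q by fastforce
  then have W: "gprod (tern i j) (fst q2) ys \<in> C i j"
    using gamma_ring.gprod_closed[OF comp_gamma_ring[OF ij]] Q[OF qs(3)] by blast
  have "lprod (mu i i i) (opt_mu i j (fst q) (snd q)) (map (\<lambda>q. opt_mu i j (fst q) (snd q)) qs)
      = mu i i i (opt_mu i j (fst q) (snd q))
          (mu i i i (opt_mu i j (fst q1) (snd q1)) (opt_mu i j (gprod (tern i j) (fst q2) ys) u))"
    using ys(4) qs(1) by simp
  also have "\<dots> = opt_mu i j (tern i j (fst q) ?g (gprod (tern i j) (fst q2) ys)) u"
    by (rule opt_mu_mult_opt_mu[OF ij _ _ W _ _ ys(3)]) (use Q Suc.prems(1) qs(2) in blast)+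
  also have "\<dots> = opt_mu i j (gprod (tern i j) (fst q) ((?g, fst q2) # ys)) u"
    by simp
  finally show ?case using set_ys ys(2,3) by (intro exI[of _ "(?g, fst q2) # ys"] exI[of _ u]) auto
qed

lemma opt_mu_set_loc_nilpotent:
  assumes ij: "i \<in> I" "j \<in> I" and NC: "N \<subseteq> C i j" and Nn: "g_loc_nilpotent (C j i) (tern i j) N"
  shows "r_loc_nilpotent (mu i i i) (opt_mu_set i j N)"
  unfolding r_loc_nilpotent_def
proof (intro allI impI)
  fix F assume F: "finite F \<and> F \<subseteq> opt_mu_set i j N"
  then have "\<forall>f\<in>F. \<exists>q. fst q \<in> N \<and> opt_ok i j (snd q) \<and> opt_mu i j (fst q) (snd q) = f"
    unfolding opt_mu_set_def by force
  then obtain rep where rep: "\<And>f. f \<in> F \<Longrightarrow> fst (rep f) \<in> N \<and> opt_ok i j (snd (rep f))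
      \<and> opt_mu i j (fst (rep f)) (snd (rep f)) = f"
    by metis
  define Q where "Q = rep ` F"
  have Q: "fst q \<in> C i j \<and> opt_ok i j (snd q)" if "q \<in> Q" for q
    using that rep NC unfolding Q_def by blast
  define \<Phi> where "\<Phi> = (\<lambda>(q, q'). opt_gamma i j (snd q) (fst q') (snd q')) ` (Q \<times> Q)"
  have "finite (fst ` Q)" "fst ` Q \<subseteq> N" unfolding Q_def using F rep by auto
  moreover have "finite \<Phi>" unfolding \<Phi>_def Q_def using F by simp
  moreover have "\<Phi> \<subseteq> C j i" unfolding \<Phi>_def using Q opt_gamma_closed[OF ij] by auto
  ultimately obtain K where
    "\<forall>x ys. x \<in> fst ` Q \<and> set ys \<subseteq> \<Phi> \<times> fst ` Q \<and> length ys = K \<longrightarrow> gprod (tern i j) x ys = 0"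
    using Nn[unfolded g_loc_nilpotent_def, rule_format, of "fst ` Q" \<Phi>] by blast
  then have K: "\<And>x ys. x \<in> fst ` Q \<Longrightarrow> set ys \<subseteq> \<Phi> \<times> fst ` Q \<Longrightarrow> length ys = K
      \<Longrightarrow> gprod (tern i j) x ys = 0"
    by blast
  have "lprod (mu i i i) x xs = 0" if x: "x \<in> F" and xs: "set xs \<subseteq> F" "length xs = 2 * K" for x xs
  proof -
    have xs_eq: "map (\<lambda>q. opt_mu i j (fst q) (snd q)) (map rep xs) = xs"
      using rep xs(1) by (induction xs) auto
    have "rep x \<in> Q" "set (map rep xs) \<subseteq> Q" using x xs(1) unfolding Q_def by auto
    from lprod_opt_mu_eq_gprod[OF ij Q this] xs(2)
    obtain ys u where "set ys \<subseteq> \<Phi> \<times> fst ` Q" "length ys = K" "opt_ok i j u"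
      "lprod (mu i i i) x xs = opt_mu i j (gprod (tern i j) (fst (rep x)) ys) u"
      unfolding \<Phi>_def xs_eq using rep[OF x] by auto
    moreover have "fst (rep x) \<in> fst ` Q" using \<open>rep x \<in> Q\<close> by blast
    ultimately show ?thesis using K opt_mu_zero[OF ij] by simp
  qed
  then show "\<exists>n. \<forall>x xs. x \<in> F \<and> set xs \<subseteq> F \<and> length xs = n \<longrightarrow> lprod (mu i i i) x xs = 0"
    by blast
qed

lemma lprod_row:
  assumes i: "i \<in> I" and x: "x \<in> A" "\<And>k l. k \<noteq> i \<Longrightarrow> x k l = 0"
    and xs: "\<And>y. y \<in> set xs \<Longrightarrow> y \<in> A \<and> (\<forall>k l. k \<noteq> i \<longrightarrow> y k l = 0)"
  shows "lprod mulA x xs \<in> A \<and> (\<forall>k l. k \<noteq> i \<longrightarrow> lprod mulA x xs k l = 0)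
    \<and> lprod mulA x xs i i = lprod (mu i i i) (x i i) (map (\<lambda>y. y i i) xs)"
  using x xs
proof (induction xs arbitrary: x)
  case (Cons y ys)
  have y: "y \<in> A" "\<And>k l. k \<noteq> i \<Longrightarrow> y k l = 0" using Cons.prems by auto
  let ?W = "lprod mulA y ys"
  have W: "?W \<in> A" "\<And>k l. k \<noteq> i \<Longrightarrow> ?W k l = 0"
    "?W i i = lprod (mu i i i) (y i i) (map (\<lambda>y. y i i) ys)"
    using Cons.IH[OF y] Cons.prems by auto
  have "mulA x ?W k l = 0" if "k \<noteq> i" for k l
    using mult_row_zero[OF Cons.prems(1) W(1)] Cons.prems(2) that by blast
  moreover have "mulA x ?W i i = mu i i i (x i i) (?W i i)"
    by (rule mult_entry_row[OF Cons.prems(1) W(1) W(2) i i])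
  ultimately show ?case using W mult_closed[OF Cons.prems(1) W(1)] by simp
qed simp

lemma row_mult_eq_zero:
  assumes i: "i \<in> I" and z: "z \<in> A" "\<And>k l. k \<noteq> i \<Longrightarrow> z k l = 0" "z i i = 0"
    and y: "y \<in> A" "\<And>k l. k \<noteq> i \<Longrightarrow> y k l = 0"
  shows "mulA z y = 0"
proof (intro ext)
  fix k l
  show "mulA z y k l = 0 k l"
  proof (cases "k = i \<and> l \<in> I")
    case True
    then have "mulA z y k l = mu i i l 0 (y i l)"
      using mult_entry_row[OF z(1) y i] z(3) by simp
    then show ?thesis using True mu_zero_left[OF i i _ carrier_entry[OF y(1) i]] by simp
  next
    case False
    then show ?thesis
      using mult_outside[of k l] mult_row_zero[OF z(1) y(1), of k l] z(2)[of k] by (cases "k = i") auto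
  qed
qed

lemma row_set_loc_nilpotent:
  assumes i: "i \<in> I" and Dn: "r_loc_nilpotent (mu i i i) D"
  shows "r_loc_nilpotent mulA (row_set i D)"
  unfolding r_loc_nilpotent_def
proof (intro allI impI)
  fix F assume F: "finite F \<and> F \<subseteq> row_set i D"
  then have row: "\<And>y. y \<in> F \<Longrightarrow> y \<in> A \<and> (\<forall>k l. k \<noteq> i \<longrightarrow> y k l = 0)"
    and diag: "(\<lambda>y. y i i) ` F \<subseteq> D"
    unfolding row_set_def by auto
  obtain m where m0: "\<forall>x xs. x \<in> (\<lambda>y. y i i) ` F \<and> set xs \<subseteq> (\<lambda>y. y i i) ` F \<and> length xs = m
      \<longrightarrow> lprod (mu i i i) x xs = 0"
    using Dn[unfolded r_loc_nilpotent_def, rule_format, of "(\<lambda>y. y i i) ` F"] F diag by blast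
  have "lprod mulA x (xs @ [y]) = 0"
    if x: "x \<in> F" and xs: "set xs \<subseteq> F" "length xs = m" and y: "y \<in> F" for x xs y
  proof -
    let ?Z = "lprod mulA x xs"
    have "?Z \<in> A \<and> (\<forall>k l. k \<noteq> i \<longrightarrow> ?Z k l = 0)
        \<and> ?Z i i = lprod (mu i i i) (x i i) (map (\<lambda>y. y i i) xs)"
      by (rule lprod_row[OF i]) (use row x xs(1) in auto)
    moreover have "lprod (mu i i i) (x i i) (map (\<lambda>y. y i i) xs) = 0"
      using m0[rule_format, of "x i i" "map (\<lambda>y. y i i) xs"] x xs by auto
    ultimately have "mulA ?Z y = 0" using row_mult_eq_zero[OF i _ _ _ _] row[OF y] by auto
    moreover have "set xs \<subseteq> A" using row xs(1) by blast
    ultimately show ?thesis using A.lprod_snoc row[OF x] row[OF y] by simp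
  qed
  then have "lprod mulA x xs = 0" if "x \<in> F" "set xs \<subseteq> F" "length xs = Suc m" for x xs
    using that by (cases xs rule: rev_cases) auto
  then show "\<exists>n. \<forall>x xs. x \<in> F \<and> set xs \<subseteq> F \<and> length xs = n \<longrightarrow> lprod mulA x xs = 0" by blast
qed

lemma single_in_levitzki:
  assumes ij: "i \<in> I" "j \<in> I" and NC: "N \<subseteq> C i j" and Nn: "g_loc_nilpotent (C j i) (tern i j) N"
    and n: "n \<in> N"
  shows "single i j n \<in> r_levitzki A mulA"
proof -
  interpret Ci: rng "C i i" "mu i i i" by (rule comp_rng[OF ij(1)])
  let ?D = "gen_subgroup (opt_mu_set i j N)"
  have "r_loc_nilpotent (mu i i i) ?D"
    using Ci.loc_nilpotent_gen_subgroup opt_mu_set_subset[OF ij NC] opt_mu_set_loc_nilpotent[OF ij NC Nn]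
    by blast
  then have "row_set i ?D \<subseteq> r_levitzki A mulA"
    using A.loc_nilpotent_right_ideal_subset_levitzki row_set_loc_nilpotent[OF ij(1)]
      row_set_right_ideal[OF ij(1) gen_subgroup.zero gen_subgroup.diff] by blast
  moreover have "single i j n \<in> row_set i ?D"
  proof -
    have nC: "n \<in> C i j" using n NC by blast
    have "single i j n i i \<in> ?D"
    proof (cases "i = j")
      case True
      then have "opt_mu i j n None \<in> opt_mu_set i j N"
        unfolding opt_mu_set_def using n by (force simp: opt_ok_def)
      then show ?thesis using True by (simp add: single_def opt_mu_def gen_subgroup.gen)
    qed (simp add: single_def gen_subgroup.zero)
    moreover have "mu i l i (single i j n i l) c \<in> ?D" if l: "l \<in> I" and c: "c \<in> C l i" for l c
    proof (cases "l = j")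
      case True
      then have "opt_mu i j n (Some c) \<in> opt_mu_set i j N"
        unfolding opt_mu_set_def using n c by (force simp: opt_ok_def)
      then show ?thesis using True by (simp add: single_def opt_mu_def gen_subgroup.gen)
    qed (use l c ij mu_zero_left in \<open>simp add: single_def gen_subgroup.zero\<close>)
    ultimately show ?thesis
      unfolding row_set_def using single_in_carrier[OF ij nC] by (auto simp: single_def)
  qed
  ultimately show ?thesis by blast
qed

lemma levitzki_eq_gm_sum: "r_levitzki A mulA = gm_sum I C (comp_rad Levitzki C mu)"
proof (rule ideal_eq_gm_sum[OF A.levitzki_ideal])
  fix i j assume ij: "i \<in> I" "j \<in> I"
  interpret Mij: gamma_ring "C i j" "C j i" "tern i j" by (rule comp_gamma_ring[OF ij])
  show "entries i j (r_levitzki A mulA) \<subseteq> comp_rad Levitzki C mu i j"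
  proof
    fix z assume "z \<in> entries i j (r_levitzki A mulA)"
    then obtain x where x: "x \<in> r_levitzki A mulA" and z: "z = x i j" unfolding entries_def by blast
    have "x \<in> gen_subgroup (\<Union>{X. r_ideal A mulA X \<and> r_loc_nilpotent mulA X})"
      using x A.levitzki_subset_gen_subgroup by blast
    then have "x i j \<in> g_levitzki (C i j) (C j i) (tern i j)"
    proof (induction x rule: gen_subgroup.induct)
      case zero
      then show ?case using g_ideal_zero[OF Mij.g_levitzki_g_ideal] by simp
    next
      case (gen x)
      then obtain X where X: "r_ideal A mulA X" "r_loc_nilpotent mulA X" "x \<in> X" by blast
      have "entries i j X \<subseteq> g_levitzki (C i j) (C j i) (tern i j)"
        using loc_nilpotent_g_ideal_subset_g_levitzki entries_g_ideal[OF X(1) ij]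
          entries_loc_nilpotent[OF X(1,2) ij] by blast
      then show ?case using X(3) unfolding entries_def by blast
    next
      case (diff a b)
      then show ?case using g_ideal_diff[OF Mij.g_levitzki_g_ideal] by simp
    qed
    then show "z \<in> comp_rad Levitzki C mu i j" unfolding comp_rad_def z by simp
  qed
  show "comp_rad Levitzki C mu i j \<subseteq> single_preimage i j (r_levitzki A mulA)"
    unfolding comp_rad_def gamma_rad.simps
  proof (rule g_levitzki_least[OF single_preimage_g_ideal[OF A.levitzki_ideal ij]])
    fix N assume N: "g_ideal (C i j) (C j i) (tern i j) N" "g_loc_nilpotent (C j i) (tern i j) N"
    then show "N \<subseteq> single_preimage i j (r_levitzki A mulA)"
      unfolding single_preimage_def using g_ideal_subset[OF N(1)] single_in_levitzki[OF ij _ N(2)]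
      by blast
  qed
qed

lemma gm_rad_eq_gm_sum: "gm_rad k I C mu = gm_sum I C (comp_rad k C mu)"
  by (cases k) (simp_all add: gm_rad_def baer_eq_gm_sum levitzki_eq_gm_sum jacobson_eq_gm_sum)

lemma gm_rad_ideal: "r_ideal A mulA (gm_rad k I C mu)"
  by (cases k) (simp_all add: gm_rad_def A.baer_ideal A.levitzki_ideal A.jacobson_ideal)

end

lemma comp_rad_subset: "comp_rad k C mu i j \<subseteq> C i j"
  unfolding comp_rad_def
  by (cases k) (simp_all add: g_baer_def Int_lower1 g_levitzki_subset g_jacobson_subset)

lemma gm_part_rad_eq_if_gm_ideal:
  assumes "gm_ideal I C mu (gm_rad k I C mu)"
  shows "gm_part_rad k I C mu = gm_rad k I C mu"
  unfolding gm_part_rad_def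
proof (rule the_equality)
  show "gm_ideal I C mu (gm_rad k I C mu) \<and> gm_rad k I C mu \<subseteq> gm_rad k I C mu
      \<and> (\<forall>B'. gm_ideal I C mu B' \<and> B' \<subseteq> gm_rad k I C mu \<longrightarrow> B' \<subseteq> gm_rad k I C mu)"
    by (simp add: assms)
  fix B assume B: "gm_ideal I C mu B \<and> B \<subseteq> gm_rad k I C mu
      \<and> (\<forall>B'. gm_ideal I C mu B' \<and> B' \<subseteq> gm_rad k I C mu \<longrightarrow> B' \<subseteq> B)"
  show "B = gm_rad k I C mu"
  proof (rule subset_antisym)
    show "B \<subseteq> gm_rad k I C mu" using B by simp
    show "gm_rad k I C mu \<subseteq> B" using B assms by simp
  qed
qed

theorem theorem2p4:
  fixes I :: "'i set" and C :: "'i \<Rightarrow> 'i \<Rightarrow> 'a::ab_group_add set"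
    and mu :: "'i \<Rightarrow> 'i \<Rightarrow> 'i \<Rightarrow> 'a \<Rightarrow> 'a \<Rightarrow> 'a" and k :: rad_kind
  assumes "gm_ring I C mu"
  shows "gm_rad k I C mu = gm_part_rad k I C mu \<and>
         gm_part_rad k I C mu = gm_sum I C (comp_rad k C mu)"
proof -
  interpret generalized_matrix_ring I C mu by (rule generalized_matrix_ring.intro[OF assms])
  have sum: "gm_rad k I C mu = gm_sum I C (comp_rad k C mu)" by (rule gm_rad_eq_gm_sum)
  have "gm_ideal I C mu (gm_rad k I C mu)"
    unfolding gm_ideal_def
  proof
    show "r_ideal A mulA (gm_rad k I C mu)" by (rule gm_rad_ideal)
    show "\<exists>S. (\<forall>i\<in>I. \<forall>j\<in>I. S i j \<subseteq> C i j) \<and> gm_rad k I C mu = gm_sum I C S"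
      using comp_rad_subset[of k C mu] sum by (intro exI[of _ "comp_rad k C mu"]) simp
  qed
  then have "gm_part_rad k I C mu = gm_rad k I C mu" by (rule gm_part_rad_eq_if_gm_ideal)
  with sum show ?thesis by simp
qed

end
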